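(* The outage probability at the destination node of the interference-aided energy-harvesting decode-and-forward relaying system is given by $$P_{\mathrm{out}}(\gamma_{\mathrm{th}})=1-\sum_{i=1}^{\upsilon(\boldsymbol{A})}\sum_{j=1}^{\tau_i(\boldsymbol{A})}\chi_{i,j}(\boldsymbol{A})\left(1-\frac{\mu_{\langle i\rangle}}{\bar\gamma_h}\right)^{-j}\Bigg\{\Gamma\left(1,\frac{\gamma_{\mathrm{th}}}{\bar\gamma_h};\frac{\gamma_{\mathrm{th}}}{\bar\gamma_h\bar\gamma_g}\right)-\frac{1}{\bar\gamma_h}\exp\left(\frac{a_{\langle i\rangle}\gamma_{\mathrm{th}}}{1+\gamma_{\mathrm{th}}}\right)\sum_{k=0}^{j-1}\frac{1}{k!}\left(\frac{-a_{\langle i\rangle}\gamma_{\mathrm{th}}}{1+\gamma_{\mathrm{th}}}\right)^k\sum_{m=0}^k\binom{k}{m}\frac{b_{\langle i\rangle}^{-1}}{(-b_{\langle i\rangle}\gamma_{\mathrm{th}})^m}\,\Gamma\left(m+1,b_{\langle i\rangle}\gamma_{\mathrm{th}};\frac{b_{\langle i\rangle}\gamma_{\mathrm{th}}}{\bar\gamma_g}\right)\Bigg\},$$ where $a_{\langle i\rangle}=\frac{1}{\mu_{\langle i\rangle}}-\frac{1}{\bar\gamma_h}$, $b_{\langle i\rangle}=\frac{1}{\bar\gamma_h}+\frac{a_{\langle i\rangle}}{1+\gamma_{\mathrm{th}}}$, and $\Gamma(a,x;b)=\int_x^\infty t^{a-1}\exp(-t-bt^{-1})\,dt$ is the generalized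 incomplete Gamma function.
   Context: System. A source communicates with a destination through a decode-and-forward relay that harvests energy from the received information signal and from $M$ co-channel interference signals, and uses it to forward the decoded signal. All channels undergo independent Rayleigh fading. The random variables $\gamma_h,\omega_1,\ldots,\omega_M,W$ are mutually independent; $\gamma_h$ is exponential with mean $\bar\gamma_h$, each $\omega_i$ is exponential with mean $1$, and $W$ is exponential with mean $\bar\gamma_g$. Put $I_R=\sum_{i=1}^M\mu_i\omega_i$ (normalized interference power at the relay). The signal-to-interference-plus-noise ratio at the relay and the signal-to-noise ratio at the destination are $$\gamma_{SR}=\frac{\gamma_h}{1+I_R},\qquad\gamma_{RD}=W(\gamma_h+I_R).$$ Parameters. $P_S$ and $P_i$ are the transmit powers of the source and of the $i$th interferer; $\Omega_h,\Omega_g,\Omega_{\beta_i}$ are the mean channel power gains of the source-relay, relay-destination and $i$th interferer-relay links; $\sigma_R^2,\sigma_D^2$ are the noise variances at relay and destination; $\eta$ is the energy conversion efficiency, with value from $0$ to $1$. In the time-switching scheme with harvesting time fraction $\alpha$, $0\le\alpha\le1$: $\bar\gamma_h=\frac{P_S}{\sigma_R^2}\Omega_h$, $\mu_i=\frac{P_i}{\sigma_R^2}\Omega_{\beta_i}$, $\bar\gamma_g=\frac{2\alpha\eta}{1-\alpha}\frac{\sigma_R^2}{\sigma_D^2}\Omega_g$. In the power-splitting scheme with harvesting power fraction $\theta$, $0\le\theta\le1$: $\bar\gamma_h=\frac{(1-\theta)P_S}{\sigma_R^2}\Omega_h$, $\mu_i=\frac{(1-\theta)P_i}{\sigma_R^2}\Omega_{\beta_i}$,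 $\bar\gamma_g=\frac{\theta\eta}{1-\theta}\frac{\sigma_R^2}{\sigma_D^2}\Omega_g$. The formula is the same for both schemes. Outage probability at the destination with pre-defined threshold $\gamma_{\mathrm{th}}$: $$P_{\mathrm{out}}(\gamma_{\mathrm{th}})=\Pr\{\gamma_{SR}\le\gamma_{\mathrm{th}}\}+\Pr\{\gamma_{SR}>\gamma_{\mathrm{th}},\ \gamma_{RD}\le\gamma_{\mathrm{th}}\}.$$ Let $\boldsymbol{A}=\mathrm{diag}(\mu_1,\ldots,\mu_M)$. $\upsilon(\boldsymbol{A})$ is the number of distinct diagonal elements of $\boldsymbol{A}$; $\mu_{\langle1\rangle}>\mu_{\langle2\rangle}>\cdots>\mu_{\langle\upsilon(\boldsymbol{A})\rangle}$ are these distinct elements in decreasing order; $\tau_i(\boldsymbol{A})$ is the multiplicity of $\mu_{\langle i\rangle}$. $\chi_{i,j}(\boldsymbol{A})$ is the $(i,j)$th characteristic coefficient of $\boldsymbol{A}$, i.e. the partial-fraction coefficient determined by $$\prod_{m=1}^M\frac{1}{1+s\mu_m}=\sum_{i=1}^{\upsilon(\boldsymbol{A})}\sum_{j=1}^{\tau_i(\boldsymbol{A})}\frac{\chi_{i,j}(\boldsymbol{A})}{(1+s\mu_{\langle i\rangle})^j},$$ so that $I_R$ has density $\sum_{i}\sum_{j}\chi_{i,j}(\boldsymbol{A})\frac{\mu_{\langle i\rangle}^{-j}}{(j-1)!}y^{j-1}e^{-y/\mu_{\langle i\rangle}}$ for $y\ge0$. *)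

theory Defs
  imports "HOL-Probability.Probability"
begin

(* The argument is the harvesting time fraction, respectively the harvesting power fraction. *)
datatype eh_scheme = Time_Switching real | Power_Splitting real

fun valid_scheme :: "eh_scheme \<Rightarrow> bool" where
  "valid_scheme (Time_Switching \<alpha>) \<longleftrightarrow> 0 \<le> \<alpha> \<and> \<alpha> \<le> 1"
| "valid_scheme (Power_Splitting \<theta>) \<longleftrightarrow> 0 \<le> \<theta> \<and> \<theta> \<le> 1"

(* Average power received at the relay for information decoding, normalised by the relay noise;
   gives the mean of gamma_h for (P_S, Omega_h) and mu_i for (P_i, Omega_beta_i). *)
fun relay_mean_snr :: "eh_scheme \<Rightarrow> real \<Rightarrow> real \<Rightarrow> real \<Rightarrow> real" where
  "relay_mean_snr (Time_Switching \<alpha>) \<sigma>\<^sub>R P \<Omega> = P / \<sigma>\<^sub>R\<^sup>2 * \<Omega>"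
| "relay_mean_snr (Power_Splitting \<theta>) \<sigma>\<^sub>R P \<Omega> = (1 - \<theta>) * P / \<sigma>\<^sub>R\<^sup>2 * \<Omega>"

fun dest_mean_gain :: "eh_scheme \<Rightarrow> real \<Rightarrow> real \<Rightarrow> real \<Rightarrow> real \<Rightarrow> real" where
  "dest_mean_gain (Time_Switching \<alpha>) \<eta> \<sigma>\<^sub>R \<sigma>\<^sub>D \<Omega> = 2 * \<alpha> * \<eta> / (1 - \<alpha>) * (\<sigma>\<^sub>R\<^sup>2 / \<sigma>\<^sub>D\<^sup>2) * \<Omega>"
| "dest_mean_gain (Power_Splitting \<theta>) \<eta> \<sigma>\<^sub>R \<sigma>\<^sub>D \<Omega> = \<theta> * \<eta> / (1 - \<theta>) * (\<sigma>\<^sub>R\<^sup>2 / \<sigma>\<^sub>D\<^sup>2) * \<Omega>"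

definition exponential_with_mean :: "'a measure \<Rightarrow> ('a \<Rightarrow> real) \<Rightarrow> real \<Rightarrow> bool" where
  "exponential_with_mean M X c \<longleftrightarrow> 0 < c \<and> distributed M lborel X (exponential_density (1 / c))"

(* Index type of the family of all channel variables, so that mutual independence is
   one indep_vars statement. *)
datatype 'm link = Source_Relay | Interferer 'm | Relay_Destination

definition interference :: "('m::finite \<Rightarrow> real) \<Rightarrow> ('m \<Rightarrow> 'a \<Rightarrow> real) \<Rightarrow> 'a \<Rightarrow> real" where
  "interference \<mu> \<omega> x = (\<Sum>i\<in>UNIV. \<mu> i * \<omega> i x)"

definition sinr_relay :: "('m::finite \<Rightarrow> real) \<Rightarrow> ('a \<Rightarrow> real) \<Rightarrow> ('m \<Rightarrow> 'a \<Rightarrow> real) \<Rightarrow> 'a \<Rightarrow> real" where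
  "sinr_relay \<mu> \<gamma>\<^sub>h \<omega> x = \<gamma>\<^sub>h x / (1 + interference \<mu> \<omega> x)"

definition snr_dest ::
  "('m::finite \<Rightarrow> real) \<Rightarrow> ('a \<Rightarrow> real) \<Rightarrow> ('m \<Rightarrow> 'a \<Rightarrow> real) \<Rightarrow> ('a \<Rightarrow> real) \<Rightarrow> 'a \<Rightarrow> real" where
  "snr_dest \<mu> \<gamma>\<^sub>h \<omega> W x = W x * (\<gamma>\<^sub>h x + interference \<mu> \<omega> x)"

definition outage_prob :: "'a measure \<Rightarrow> ('a \<Rightarrow> real) \<Rightarrow> ('a \<Rightarrow> real) \<Rightarrow> real \<Rightarrow> real" where
  "outage_prob M SR RD t =
     measure M {x \<in> space M. SR x \<le> t} + measure M {x \<in> space M. SR x > t \<and> RD x \<le> t}"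

definition diag_matrix :: "('m::finite \<Rightarrow> real) \<Rightarrow> real^'m^'m" where
  "diag_matrix \<mu> = (\<chi> i j. if i = j then \<mu> i else 0)"

definition diag_elems :: "real^'m::finite^'m \<Rightarrow> real set" where
  "diag_elems A = range (\<lambda>m. A $ m $ m)"

definition num_distinct :: "real^'m::finite^'m \<Rightarrow> nat" where
  "num_distinct A = card (diag_elems A)"

(* Indices start at 1: diag_nth A 1 > diag_nth A 2 > ... > diag_nth A (num_distinct A). *)
definition diag_nth :: "real^'m::finite^'m \<Rightarrow> nat \<Rightarrow> real" where
  "diag_nth A i = rev (sorted_list_of_set (diag_elems A)) ! (i - 1)"

definition diag_mult :: "real^'m::finite^'m \<Rightarrow> nat \<Rightarrow> nat" where
  "diag_mult A i = card {m. A $ m $ m = diag_nth A i}"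

(* Determined by the partial fraction identity when all diagonal elements are nonzero;
   the value 0 outside the index range only serves to make the function unique. *)
definition char_coeff :: "real^'m::finite^'m \<Rightarrow> nat \<Rightarrow> nat \<Rightarrow> real" where
  "char_coeff A = (THE c.
     (\<forall>s. (\<forall>m. 1 + s * A $ m $ m \<noteq> 0) \<longrightarrow>
        (\<Prod>m\<in>UNIV. 1 / (1 + s * A $ m $ m)) =
        (\<Sum>i=1..num_distinct A. \<Sum>j=1..diag_mult A i. c i j / (1 + s * diag_nth A i) ^ j)) \<and>
     (\<forall>i j. \<not> (i \<in> {1..num_distinct A} \<and> j \<in> {1..diag_mult A i}) \<longrightarrow> c i j = 0))"

definition gen_inc_Gamma :: "real \<Rightarrow> real \<Rightarrow> real \<Rightarrow> real" where
  "gen_inc_Gamma a x b = (LINT t:{x..}|lborel. t powr (a - 1) * exp (- t - b / t))"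

end

theory Submission
  imports Defs
begin

text \<open>
  Outage is the complement of the event that \<open>\<gamma>\<^sub>h > t (1 + I)\<close> and \<open>W (\<gamma>\<^sub>h + I) > t\<close>, where \<open>I\<close> is the
  interference and \<open>t\<close> the threshold. With \<open>N = \<gamma>\<^sub>h + I\<close>, the first condition reads
  \<open>I < (N - t) / (1 + t)\<close> and the second has conditional probability \<open>exp (- t / (g\<^sub>g N))\<close>. Integrating out
  \<open>I\<close> at fixed \<open>N\<close> leaves incomplete Gamma sums, and integrating those over \<open>N\<close> gives the
  generalized incomplete Gamma functions.

  Convolving with exponential densities acts on mixtures of Gamma densities exactly as multiplication
  by \<open>1 / (1 + s u)\<close> acts on their Laplace transforms. Carrying both along in one induction on the number
  of interferers yields the density of \<open>I\<close> and the existence of the partial fraction expansion together;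
  uniqueness of the latter identifies the mixture weights with the characteristic coefficients.
\<close>

subsection \<open>Gamma mixtures and partial fractions\<close>

text \<open>
  The Gamma density is continued to all of the real line so that the
  derivative relation below holds everywhere; the value at order 0 makes it hold for \<open>k = 0\<close> as well.
\<close>

primrec gamma_kernel :: "real \<Rightarrow> nat \<Rightarrow> real \<Rightarrow> real" where
  "gamma_kernel v 0 y = 0"
| "gamma_kernel v (Suc k) y = y ^ k * exp (- y / v) / (v ^ Suc k * fact k)"

lemma gamma_kernel_at_0: "gamma_kernel v j 0 = (if j = 1 then 1 / v else 0)"
  by (cases j) (auto simp: power_0_left)

text \<open>In differential form: raising the order by one is convolution with the exponential
  density of the same mean \<open>v\<close>.\<close>

lemma has_field_derivative_gamma_kernel:
  assumes "v \<noteq> 0"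
  shows "(gamma_kernel v (Suc k) has_field_derivative
    (gamma_kernel v k y - gamma_kernel v (Suc k) y) / v) (at y)"
proof (cases k)
  case 0
  have *: "gamma_kernel v (Suc 0) = (\<lambda>y. exp (- y / v) / v)"
    by (simp add: fun_eq_iff)
  show ?thesis unfolding 0 *
    by (rule derivative_eq_intros refl | use assms in simp)+
next
  case (Suc i)
  have *: "gamma_kernel v (Suc (Suc i)) = (\<lambda>y. y ^ Suc i * exp (- y / v) / (v ^ Suc (Suc i) * fact (Suc i)))"
    by (simp add: fun_eq_iff)
  have f: "fact (Suc i) = real (Suc i) * fact i" by simp
  have "((\<lambda>y. y ^ Suc i * exp (- y / v) / (v ^ Suc (Suc i) * fact (Suc i))) has_field_derivative
    (real (Suc i) * y ^ i * exp (- y / v) + y ^ Suc i * (exp (- y / v) * (- 1 / v))) / (v ^ Suc (Suc i) * fact (Suc i))) (at y)"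
    using assms by (auto intro!: derivative_eq_intros simp del: power_Suc fact_Suc)
  also have "(real (Suc i) * y ^ i * exp (- y / v) + y ^ Suc i * (exp (- y / v) * (- 1 / v))) / (v ^ Suc (Suc i) * fact (Suc i))
    = (gamma_kernel v k y - gamma_kernel v (Suc k) y) / v"
    unfolding Suc gamma_kernel.simps f using assms
    by (simp add: divide_simps del: of_nat_Suc) (simp add: algebra_simps del: of_nat_Suc)?
  finally show ?thesis unfolding Suc * .
qed

text \<open>
  Linear combinations of Gamma densities of scale \<open>v\<close> and order at most \<open>n v\<close>, each paired with its
  Laplace transform (with the junk value 0 at the poles).
\<close>

inductive gamma_span :: "(real \<Rightarrow> nat) \<Rightarrow> (real \<Rightarrow> real) \<Rightarrow> (real \<Rightarrow> real) \<Rightarrow> bool" for n where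
  zero: "gamma_span n (\<lambda>y. 0) (\<lambda>s. 0)"
| base: "1 \<le> j \<Longrightarrow> j \<le> n v \<Longrightarrow> gamma_span n (gamma_kernel v j) (\<lambda>s. 1 / (1 + s * v) ^ j)"
| add: "gamma_span n f F \<Longrightarrow> gamma_span n g G \<Longrightarrow> gamma_span n (\<lambda>y. f y + g y) (\<lambda>s. F s + G s)"
| scale: "gamma_span n f F \<Longrightarrow> gamma_span n (\<lambda>y. r * f y) (\<lambda>s. r * F s)"

text \<open>A single family \<open>c\<close> represents both the function and its transform, so
  coefficients determined from the transform carry over to the density.\<close>

lemma gamma_span_coefficients:
  assumes "gamma_span n f F" "finite V" "\<And>v. v \<notin> V \<Longrightarrow> n v = 0"
  shows "\<exists>c. (\<forall>y. f y = (\<Sum>v\<in>V. \<Sum>j=1..n v. c v j * gamma_kernel v j y)) \<and>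
    (\<forall>s. F s = (\<Sum>v\<in>V. \<Sum>j=1..n v. c v j / (1 + s * v) ^ j))"
  using assms(1)
proof induction
  case zero
  show ?case by (rule exI[of _ "\<lambda>v j. 0"]) simp
next
  case (base j v)
  have v: "v \<in> V" using base assms(3)[of v] by force
  \<comment> \<open>\<open>h\<close> stays arbitrary so that one selection identity serves both the
    kernel and the transform.\<close>
  have *: "(\<Sum>w\<in>V. \<Sum>i=1..n w. (if w = v \<and> i = j then 1 else 0) * h w i) = h v j" for h :: "real \<Rightarrow> nat \<Rightarrow> real"
  proof -
    have "(\<Sum>w\<in>V. \<Sum>i=1..n w. (if w = v \<and> i = j then 1 else 0) * h w i)
      = (\<Sum>w\<in>V. if w = v then h v j else 0)"
    proof (rule sum.cong, simp)
      fix w show "(\<Sum>i=1..n w. (if w = v \<and> i = j then 1 else 0) * h w i) = (if w = v then h v j else 0)"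
        using base by (cases "w = v") (simp_all add: if_distrib[where f="\<lambda>x. x * _"] sum.delta cong: if_cong)
    qed
    then show ?thesis using v assms(2) by simp
  qed
  show ?case
    by (rule exI[of _ "\<lambda>w i. if w = v \<and> i = j then 1 else 0"])
      (use *[of "\<lambda>w i. gamma_kernel w i y" for y] *[of "\<lambda>w i. 1 / (1 + s * w) ^ i" for s] in
       \<open>simp add: if_distrib[where f="\<lambda>x. x / _"] if_distrib[where f="\<lambda>x. x * _"] cong: if_cong\<close>)
next
  case (add f F g G)
  then obtain c d where
    "\<forall>y. f y = (\<Sum>v\<in>V. \<Sum>j=1..n v. c v j * gamma_kernel v j y)"
    "\<forall>s. F s = (\<Sum>v\<in>V. \<Sum>j=1..n v. c v j / (1 + s * v) ^ j)"
    "\<forall>y. g y = (\<Sum>v\<in>V. \<Sum>j=1..n v. d v j * gamma_kernel v j y)"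
    "\<forall>s. G s = (\<Sum>v\<in>V. \<Sum>j=1..n v. d v j / (1 + s * v) ^ j)"
    by blast
  then show ?case
    by (intro exI[of _ "\<lambda>v j. c v j + d v j"]) (simp add: sum.distrib distrib_right add_divide_distrib)
next
  case (scale f F r)
  then obtain c where
    "\<forall>y. f y = (\<Sum>v\<in>V. \<Sum>j=1..n v. c v j * gamma_kernel v j y)"
    "\<forall>s. F s = (\<Sum>v\<in>V. \<Sum>j=1..n v. c v j / (1 + s * v) ^ j)"
    by blast
  then show ?case
    by (intro exI[of _ "\<lambda>v j. r * c v j"]) (simp add: sum_distrib_left mult.assoc)
qed

text \<open>
  Convolving \<open>f\<close> with the exponential density of mean \<open>u\<close> gives the solution of
  \<open>g' = (f - g) / u\<close> with \<open>g 0 = 0\<close>. The start \<open>j = 0\<close> of the induction stands for a point mass at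
  the origin, whose convolution is the exponential density itself; the step is the partial fraction
  expansion of \<open>1 / ((1 + s v) (1 + s u))\<close>.
\<close>

lemma gamma_kernel_convolve_exponential:
  assumes "v \<noteq> 0" "u \<noteq> 0" "u \<noteq> v" "1 \<le> n u" "j \<le> n v"
  shows "\<exists>g G. gamma_span n g G \<and> g 0 = (if j = 0 then 1 / u else 0) \<and>
    (\<forall>y. (g has_field_derivative (gamma_kernel v j y - g y) / u) (at y)) \<and>
    (\<forall>s. 1 + s * u \<noteq> 0 \<longrightarrow> 1 + s * v \<noteq> 0 \<longrightarrow> G s = 1 / (1 + s * v) ^ j / (1 + s * u))"
  using assms(5)
proof (induction j)
  case 0
  show ?case
  proof (intro exI conjI allI impI)
    show "gamma_span n (gamma_kernel u (Suc 0)) (\<lambda>s. 1 / (1 + s * u) ^ Suc 0)"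
      using assms by (intro gamma_span.base) auto
    show "(gamma_kernel u (Suc 0) has_field_derivative (gamma_kernel v 0 y - gamma_kernel u (Suc 0) y) / u) (at y)" for y
      using has_field_derivative_gamma_kernel[OF assms(2), of 0 y] by (simp only: gamma_kernel.simps(1))
    show "gamma_kernel u (Suc 0) 0 = (if (0::nat) = 0 then 1 / u else 0)"
      by (simp add: gamma_kernel_at_0 del: gamma_kernel.simps(2))
  qed simp_all
next
  case (Suc j)
  then obtain g G where g: "gamma_span n g G" "g 0 = (if j = 0 then 1 / u else 0)"
    "\<And>y. (g has_field_derivative (gamma_kernel v j y - g y) / u) (at y)"
    "\<And>s. 1 + s * u \<noteq> 0 \<Longrightarrow> 1 + s * v \<noteq> 0 \<Longrightarrow> G s = 1 / (1 + s * v) ^ j / (1 + s * u)"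
    by auto
  \<comment> \<open>The constants of \<open>1 / ((1 + s * v) * (1 + s * u)) = p / (1 + s * v) + q /
    (1 + s * u)\<close>. After division by \<open>(1 + s * v) ^ j\<close> the second summand is
    \<open>q\<close> times the transform from the induction hypothesis.\<close>
  define p q where "p = v / (v - u)" and "q = - u / (v - u)"
  have pq: "p + q = 1" "p * u + q * v = 0" "p / v + q / u = 0" "(1 - p) / u = - (p / v)"
    using assms unfolding p_def q_def by (simp_all add: divide_simps) (simp_all add: algebra_simps)?
  show ?case
  proof (intro exI conjI allI impI)
    show "gamma_span n (\<lambda>y. p * gamma_kernel v (Suc j) y + q * g y)
        (\<lambda>s. p * (1 / (1 + s * v) ^ Suc j) + q * G s)"
      using Suc g(1) by (intro gamma_span.intros) auto
    show "p * gamma_kernel v (Suc j) 0 + q * g 0 = (if Suc j = 0 then 1 / u else 0)"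
      using pq(3) by (auto simp: gamma_kernel_at_0 g(2) simp del: gamma_kernel.simps(2))
    fix y
    have "q / u = - (p / v)" "1 / u - p / u = - (p / v)" using pq by (auto simp: diff_divide_distrib)
    \<comment> \<open>\<open>a\<close>, \<open>b\<close>, \<open>c\<close> stand for
      \<open>gamma_kernel v j y\<close>, \<open>gamma_kernel v (Suc j) y\<close> and
      \<open>g y\<close>; \<open>a\<close> drops out because
      \<open>p / v + q / u = 0\<close>.\<close>
    then have *: "p * ((a - b) / v) + q * ((a - c) / u) = (b - (p * b + q * c)) / u" for a b c
    proof -
      have "p * ((a - b) / v) + q * ((a - c) / u) = (p / v + q / u) * a - (p / v) * b - (q / u) * c"
        using assms(1,2) by (simp add: field_simps)
      also have "\<dots> = (1 / u - p / u) * b - (q / u) * c"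
        unfolding pq(3) \<open>1 / u - p / u = - (p / v)\<close> by simp
      also have "\<dots> = (b - (p * b + q * c)) / u"
        using assms(2) by (simp add: field_simps)
      finally show ?thesis .
    qed
    show "((\<lambda>y. p * gamma_kernel v (Suc j) y + q * g y) has_field_derivative
      (gamma_kernel v (Suc j) y - (p * gamma_kernel v (Suc j) y + q * g y)) / u) (at y)"
      using DERIV_add[OF DERIV_cmult[OF has_field_derivative_gamma_kernel[OF assms(1)], of p j y]
          DERIV_cmult[OF g(3), of q y]]
      by (simp only: *)
  next
    fix s assume s: "1 + s * u \<noteq> 0" "1 + s * v \<noteq> 0"
    have *: "p * (1 + s * u) + q * (1 + s * v) = 1"
    proof -
      have "p * (1 + s * u) + q * (1 + s * v) = (p + q) + s * (p * u + q * v)" by (simp add: algebra_simps)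
      then show ?thesis using pq by simp
    qed
    have "p * (1 / (1 + s * v) ^ Suc j) + q * G s
       = (p * (1 + s * u) + q * (1 + s * v)) / ((1 + s * v) ^ Suc j * (1 + s * u))"
      using s by (simp add: g(4) divide_simps)
    then show "p * (1 / (1 + s * v) ^ Suc j) + q * G s = 1 / (1 + s * v) ^ Suc j / (1 + s * u)"
      unfolding * by simp
  qed
qed

text \<open>The equation for \<open>g\<close> is linear in \<open>f\<close>, so single kernels
  suffice. A kernel of scale \<open>u\<close> gains one order; any other keeps its order and adds a
  first-order term at \<open>u\<close>. Hence the bound grows only at \<open>u\<close>, by one.
  Transforms are compared off the poles, where no junk values enter.\<close>

lemma gamma_span_convolve_exponential:
  assumes "gamma_span n f F" and u: "u \<noteq> 0" and nz: "\<And>v. 0 < n v \<Longrightarrow> v \<noteq> 0"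
  shows "\<exists>g G. gamma_span (n(u := Suc (n u))) g G \<and> g 0 = 0 \<and>
    (\<forall>y. (g has_field_derivative (f y - g y) / u) (at y)) \<and>
    (\<forall>s. 1 + s * u \<noteq> 0 \<longrightarrow> (\<forall>v. 0 < n v \<longrightarrow> 1 + s * v \<noteq> 0) \<longrightarrow> G s = F s / (1 + s * u))"
  using assms(1)
proof induction
  case zero
  show ?case
    by (intro exI[of _ "\<lambda>_. 0"] conjI gamma_span.zero) auto
next
  case (base j v)
  have v: "v \<noteq> 0" "0 < n v" using base nz[of v] by auto
  show ?case
  proof (cases "u = v")
    case True
    show ?thesis
    proof (intro exI conjI allI impI)
      show "gamma_span (n(u := Suc (n u))) (gamma_kernel v (Suc j)) (\<lambda>s. 1 / (1 + s * v) ^ Suc j)"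
        using base True by (intro gamma_span.base) auto
      show "gamma_kernel v (Suc j) 0 = 0" using base by (simp add: gamma_kernel_at_0 del: gamma_kernel.simps(2))
      show "(gamma_kernel v (Suc j) has_field_derivative (gamma_kernel v j y - gamma_kernel v (Suc j) y) / u) (at y)" for y
        using has_field_derivative_gamma_kernel[OF v(1), of j y] unfolding True .
    qed (simp add: True mult.commute)
  next
    case False
    then have "1 \<le> (n(u := Suc (n u))) u" "j \<le> (n(u := Suc (n u))) v" using base by auto
    from gamma_kernel_convolve_exponential[OF v(1) u False this] obtain g G where
      "gamma_span (n(u := Suc (n u))) g G \<and> g 0 = (if j = 0 then 1 / u else 0) \<and>
      (\<forall>y. (g has_field_derivative (gamma_kernel v j y - g y) / u) (at y)) \<and>
      (\<forall>s. 1 + s * u \<noteq> 0 \<longrightarrow> 1 + s * v \<noteq> 0 \<longrightarrow> G s = 1 / (1 + s * v) ^ j / (1 + s * u))"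
      by (elim exE) (rule that)
    then show ?thesis using base v
      by - (rule exI[of _ g], rule exI[of _ G], simp del: fun_upd_apply)
  qed
next
  case (add f F g G)
  from add.IH(1) obtain f' F' where
    "gamma_span (n(u := Suc (n u))) f' F' \<and> f' 0 = 0 \<and>
    (\<forall>y. (f' has_field_derivative (f y - f' y) / u) (at y)) \<and>
    (\<forall>s. 1 + s * u \<noteq> 0 \<longrightarrow> (\<forall>v. 0 < n v \<longrightarrow> 1 + s * v \<noteq> 0) \<longrightarrow> F' s = F s / (1 + s * u))"
    by (elim exE) (rule that)
  note f = this[THEN conjunct1] this[THEN conjunct2, THEN conjunct1]
    this[THEN conjunct2, THEN conjunct2, THEN conjunct1, rule_format]
    this[THEN conjunct2, THEN conjunct2, THEN conjunct2, rule_format]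
  from add.IH(2) obtain g' G' where
    "gamma_span (n(u := Suc (n u))) g' G' \<and> g' 0 = 0 \<and>
    (\<forall>y. (g' has_field_derivative (g y - g' y) / u) (at y)) \<and>
    (\<forall>s. 1 + s * u \<noteq> 0 \<longrightarrow> (\<forall>v. 0 < n v \<longrightarrow> 1 + s * v \<noteq> 0) \<longrightarrow> G' s = G s / (1 + s * u))"
    by (elim exE) (rule that)
  note g = this[THEN conjunct1] this[THEN conjunct2, THEN conjunct1]
    this[THEN conjunct2, THEN conjunct2, THEN conjunct1, rule_format]
    this[THEN conjunct2, THEN conjunct2, THEN conjunct2, rule_format]
  show ?case
  proof (rule exI[of _ "\<lambda>y. f' y + g' y"], rule exI[of _ "\<lambda>s. F' s + G' s"], intro conjI allI impI)
    show "gamma_span (n(u := Suc (n u))) (\<lambda>y. f' y + g' y) (\<lambda>s. F' s + G' s)"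
      by (intro gamma_span.add f g)
    show "((\<lambda>y. f' y + g' y) has_field_derivative ((f y + g y) - (f' y + g' y)) / u) (at y)" for y
      using DERIV_add[OF f(3) g(3), of y] by (simp add: diff_divide_distrib add_divide_distrib algebra_simps)
  qed (simp_all add: f(2) g(2) f(4) g(4) add_divide_distrib)
next
  case (scale f F r)
  from scale.IH obtain f' F' where
    "gamma_span (n(u := Suc (n u))) f' F' \<and> f' 0 = 0 \<and>
    (\<forall>y. (f' has_field_derivative (f y - f' y) / u) (at y)) \<and>
    (\<forall>s. 1 + s * u \<noteq> 0 \<longrightarrow> (\<forall>v. 0 < n v \<longrightarrow> 1 + s * v \<noteq> 0) \<longrightarrow> F' s = F s / (1 + s * u))"
    by (elim exE) (rule that)
  note f = this[THEN conjunct1] this[THEN conjunct2, THEN conjunct1]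
    this[THEN conjunct2, THEN conjunct2, THEN conjunct1, rule_format]
    this[THEN conjunct2, THEN conjunct2, THEN conjunct2, rule_format]
  show ?case
  proof (rule exI[of _ "\<lambda>y. r * f' y"], rule exI[of _ "\<lambda>s. r * F' s"], intro conjI allI impI)
    show "gamma_span (n(u := Suc (n u))) (\<lambda>y. r * f' y) (\<lambda>s. r * F' s)"
      by (intro gamma_span.scale f)
    show "((\<lambda>y. r * f' y) has_field_derivative (r * f y - r * f' y) / u) (at y)" for y
      using DERIV_cmult[OF f(3), of r y] by (simp add: right_diff_distrib)
  qed (simp_all add: f(2) f(4))
qed

section \<open>Uniqueness of partial fraction coefficients\<close>

text \<open>Multiply the vanishing sum by \<open>(1 + s * w) ^ l\<close>, with \<open>l\<close> the
  highest order that has a nonzero coefficient at \<open>w\<close>, and let \<open>s\<close> tend to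
  the pole \<open>- 1 / w\<close>: only \<open>c w l\<close> survives, so it would be zero.\<close>

lemma partial_fraction_coefficients_zero:
  fixes c :: "real \<Rightarrow> nat \<Rightarrow> real" and V :: "real set"
  assumes V: "finite V" "0 \<notin> V"
    and eq: "\<And>s. (\<forall>v\<in>V. 1 + s * v \<noteq> 0) \<Longrightarrow> (\<Sum>v\<in>V. \<Sum>j=1..n v. c v j / (1 + s * v) ^ j) = 0"
    and w: "w \<in> V" "i \<in> {1..n w}"
  shows "c w i = 0"
proof (rule ccontr)
  assume nz: "c w i \<noteq> 0"
  define J where "J = {j \<in> {1..n w}. c w j \<noteq> 0}"
  define l where "l = Max J"
  have "finite J" "i \<in> J" using nz w by (auto simp: J_def)
  then have l: "l \<in> J" "\<And>j. j \<in> J \<Longrightarrow> j \<le> l" unfolding l_def by (auto intro: Max_in)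
  define s0 where "s0 = - 1 / w"
  have w0: "w \<noteq> 0" "1 + s0 * w = 0" using w V by (auto simp: s0_def)
  have lim: "((\<lambda>s. \<Sum>v\<in>V. \<Sum>j=1..n v. c v j / (1 + s * v) ^ j * (1 + s * w) ^ l) \<longlongrightarrow>
     (\<Sum>v\<in>V. \<Sum>j=1..n v. if v = w \<and> j = l then c w l else 0)) (at s0)"
  proof (intro tendsto_sum)
    fix v j assume v: "v \<in> V" and j: "j \<in> {1..n v}"
    show "((\<lambda>s. c v j / (1 + s * v) ^ j * (1 + s * w) ^ l) \<longlongrightarrow> (if v = w \<and> j = l then c w l else 0)) (at s0)"
    proof (cases "v = w")
      case False
      have "v \<noteq> 0" using v V by auto
      then have "1 + s0 * v \<noteq> 0" using False w0 by (auto simp: s0_def field_simps)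
      moreover have "0 < l" using l by (auto simp: J_def)
      ultimately have "((\<lambda>s. c v j / (1 + s * v) ^ j * (1 + s * w) ^ l) \<longlongrightarrow> c v j / (1 + s0 * v) ^ j * (1 + s0 * w) ^ l) (at s0)"
        by (intro tendsto_intros) auto
      then show ?thesis using False w0 \<open>0 < l\<close> by (simp add: power_0_left)
    next
      case True
      show ?thesis
      proof (cases "c w j = 0")
        case c0: True
        then show ?thesis using True l by (auto simp: J_def)
      next
        case False
        \<comment> \<open>Cancelling leaves the power \<open>l - j\<close>, whose limit at the pole
          is 1 for \<open>j = l\<close> and 0 for smaller \<open>j\<close>. The cancellation is
          valid only off the pole, hence eventually.\<close>
        then have jl: "j \<le> l" using j l True by (auto simp: J_def)
        have "((\<lambda>s. c w j * (1 + s * w) ^ (l - j)) \<longlongrightarrow> c w j * (1 + s0 * w) ^ (l - j)) (at s0)"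
          by (intro tendsto_intros)
        also have "c w j * (1 + s0 * w) ^ (l - j) = (if v = w \<and> j = l then c w l else 0)"
          using True jl w0 by (auto simp: power_0_left)
        finally have *: "((\<lambda>s. c w j * (1 + s * w) ^ (l - j)) \<longlongrightarrow> (if v = w \<and> j = l then c w l else 0)) (at s0)" .
        show ?thesis
        proof (rule Lim_transform_eventually[OF *])
          show "\<forall>\<^sub>F s in at s0. c w j * (1 + s * w) ^ (l - j) = c v j / (1 + s * v) ^ j * (1 + s * w) ^ l"
          proof (subst eventually_at_filter, rule eventuallyI, intro impI)
            fix s assume "s \<noteq> s0"
            then have "1 + s * w \<noteq> 0" using w0 by (auto simp: s0_def field_simps)
            then show "c w j * (1 + s * w) ^ (l - j) = c v j / (1 + s * v) ^ j * (1 + s * w) ^ l"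
              using True jl by (simp add: power_diff)
          qed
        qed
      qed
    qed
  qed
  have "(\<Sum>v\<in>V. \<Sum>j=1..n v. if v = w \<and> j = l then c w l else 0) = c w l"
  proof -
    have "(\<Sum>v\<in>V. \<Sum>j=1..n v. if v = w \<and> j = l then c w l else 0) = (\<Sum>v\<in>V. if v = w then c w l else 0)"
    proof (rule sum.cong, simp)
      fix v show "(\<Sum>j=1..n v. if v = w \<and> j = l then c w l else 0) = (if v = w then c w l else 0)"
        using l by (cases "v = w") (auto simp: J_def)
    qed
    then show ?thesis using V w by simp
  qed
  moreover have "((\<lambda>s. \<Sum>v\<in>V. \<Sum>j=1..n v. c v j / (1 + s * v) ^ j * (1 + s * w) ^ l) \<longlongrightarrow> 0) (at s0)"
  proof (rule Lim_transform_eventually[OF tendsto_const])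
    \<comment> \<open>There are finitely many poles: those other than \<open>s0\<close> are avoided
      near \<open>s0\<close>, and \<open>at s0\<close> leaves out \<open>s0\<close> itself.\<close>
    have "\<forall>\<^sub>F s in at s0. \<forall>v\<in>V. 1 + s * v \<noteq> 0"
    proof (intro eventually_ball_finite ballI V)
      fix v assume "v \<in> V"
      then have "v \<noteq> 0" using V by auto
      then have "\<And>s. 1 + s * v = 0 \<Longrightarrow> s = - 1 / v" by (simp add: field_simps)
      moreover have "\<forall>\<^sub>F s in at s0. s \<noteq> - 1 / v"
        by (cases "s0 = - 1 / v") (auto simp: eventually_neq_at_within intro: eventually_neq_at_within tendsto_imp_eventually_ne[OF tendsto_ident_at])
      ultimately show "\<forall>\<^sub>F s in at s0. 1 + s * v \<noteq> 0" by (auto elim: eventually_mono)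
    qed
    then show "\<forall>\<^sub>F s in at s0. 0 = (\<Sum>v\<in>V. \<Sum>j=1..n v. c v j / (1 + s * v) ^ j * (1 + s * w) ^ l)"
    proof eventually_elim
      fix s assume "\<forall>v\<in>V. 1 + s * v \<noteq> 0"
      then have "0 = (\<Sum>v\<in>V. \<Sum>j=1..n v. c v j / (1 + s * v) ^ j) * (1 + s * w) ^ l"
        by (simp only: eq mult_zero_left)
      then show "0 = (\<Sum>v\<in>V. \<Sum>j=1..n v. c v j / (1 + s * v) ^ j * (1 + s * w) ^ l)"
        by (simp only: sum_distrib_right)
    qed
  qed
  ultimately have "c w l = 0"
    using tendsto_unique[OF trivial_limit_at lim] by simp
  then show False using l by (auto simp: J_def)
qed

subsection \<open>The density of the interference\<close>

lemma borel_measurable_gamma_kernel [measurable]: "gamma_kernel v j \<in> borel_measurable borel"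
proof (cases j)
  case 0
  have "gamma_kernel v 0 = (\<lambda>y. 0)" by (simp add: fun_eq_iff)
  then show ?thesis using 0 by simp
next
  case (Suc k)
  have "gamma_kernel v (Suc k) = (\<lambda>y. y ^ k * exp (- y / v) / (v ^ Suc k * fact k))"
    by (simp add: fun_eq_iff)
  then show ?thesis using Suc by simp
qed

lemma borel_measurable_gamma_span: "gamma_span n f F \<Longrightarrow> f \<in> borel_measurable borel"
  by (induction rule: gamma_span.induct) auto

text \<open>By an integrating factor, \<open>g y * exp ((y - x) / u)\<close> has the integrand of
  the convolution at \<open>x\<close> as its derivative. Monotonicity gives nonnegativity of
  \<open>g\<close>; the fundamental theorem on \<open>{0..x}\<close> gives the integral, the
  boundary term at 0 vanishing by \<open>g 0 = 0\<close>.\<close>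

lemma convolution_exponential_density:
  fixes f g :: "real \<Rightarrow> real"
  assumes u: "0 < u" and [measurable]: "f \<in> borel_measurable borel" and f: "\<And>y. 0 \<le> y \<Longrightarrow> 0 \<le> f y"
    and g: "g 0 = 0" "\<And>y. (g has_field_derivative (f y - g y) / u) (at y)"
  shows "0 \<le> y \<Longrightarrow> 0 \<le> g y"
    and "(\<integral>\<^sup>+y. ennreal (exponential_density (1 / u) (x - y)) * ennreal (f y * indicator {0..} y) \<partial>lborel)
      = ennreal (g x * indicator {0..} x)"
proof -
  have D: "((\<lambda>y. g y * exp ((y - x) / u)) has_field_derivative f y * (exp ((y - x) / u) / u)) (at y)" for x y
    using u by (auto intro!: derivative_eq_intros g(2)) (simp add: field_simps)
  show "0 \<le> g y" if "0 \<le> y" for y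
  proof -
    have "g 0 * exp ((0 - y) / u) \<le> g y * exp ((y - y) / u)"
      using that D u f by (intro DERIV_nonneg_imp_nondecreasing[of 0 y "\<lambda>z. g z * exp ((z - y) / u)"]) fastforce+
    then show ?thesis using g by simp
  qed
  show "(\<integral>\<^sup>+y. ennreal (exponential_density (1 / u) (x - y)) * ennreal (f y * indicator {0..} y) \<partial>lborel)
      = ennreal (g x * indicator {0..} x)"
  proof (cases "0 \<le> x")
    case True
    have "(\<integral>\<^sup>+y. ennreal (exponential_density (1 / u) (x - y)) * ennreal (f y * indicator {0..} y) \<partial>lborel)
      = (\<integral>\<^sup>+y. ennreal (f y * (exp ((y - x) / u) / u)) * indicator {0..x} y \<partial>lborel)"
    proof (intro nn_integral_cong)
      fix y
      show "ennreal (exponential_density (1 / u) (x - y)) * ennreal (f y * indicator {0..} y)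
        = ennreal (f y * (exp ((y - x) / u) / u)) * indicator {0..x} y"
        using u f[of y] by (auto simp: exponential_density_def indicator_def ennreal_mult[symmetric] algebra_simps diff_divide_distrib)
    qed
    also have "\<dots> = g x * exp ((x - x) / u) - g 0 * exp ((0 - x) / u)"
      using True u f by (intro nn_integral_FTC_Icc D) auto
    finally show ?thesis using g True by simp
  next
    \<comment> \<open>For negative \<open>x\<close> the supports \<open>y \<le> x\<close> and
      \<open>0 \<le> y\<close> are disjoint.\<close>
    case False
    then have *: "ennreal (exponential_density (1 / u) (x - y)) * ennreal (f y * indicator {0..} y) = 0" for y
      by (auto simp: exponential_density_def indicator_def)
    show ?thesis unfolding * using False by simp
  qed
qed

text \<open>The induction starts at one summand because the empty sum is a point mass without
  density. The order bound at \<open>v\<close> is the number of summands of mean \<open>v\<close>,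
  which becomes the range of \<open>j\<close> in the characteristic coefficients.\<close>

lemma (in prob_space) exponential_sum_density:
  fixes X :: "'i \<Rightarrow> 'a \<Rightarrow> real"
  assumes "finite S" "S \<noteq> {}" "indep_vars (\<lambda>_. borel) X S" "\<And>i. i \<in> S \<Longrightarrow> 0 < \<mu> i"
    and "\<And>i. i \<in> S \<Longrightarrow> distributed M lborel (X i) (exponential_density (1 / \<mu> i))"
  shows "\<exists>f F. gamma_span (\<lambda>v. card {i \<in> S. \<mu> i = v}) f F \<and>
    (\<forall>s. (\<forall>i\<in>S. 1 + s * \<mu> i \<noteq> 0) \<longrightarrow> F s = (\<Prod>i\<in>S. 1 / (1 + s * \<mu> i))) \<and>
    (\<forall>y\<ge>0. 0 \<le> f y) \<and>
    distributed M lborel (\<lambda>x. \<Sum>i\<in>S. X i x) (\<lambda>y. ennreal (f y * indicator {0..} y))"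
  using assms
proof (induction S rule: finite_ne_induct)
  case (singleton i)
  have "{j \<in> {i}. \<mu> j = \<mu> i} = {i}" by auto
  then have 1: "gamma_span (\<lambda>v. card {j \<in> {i}. \<mu> j = v}) (gamma_kernel (\<mu> i) 1) (\<lambda>s. 1 / (1 + s * \<mu> i) ^ 1)"
    by (intro gamma_span.base) auto
  have "0 < \<mu> i" and d: "distributed M lborel (X i) (exponential_density (1 / \<mu> i))" using singleton by auto
  have "(\<lambda>y. ennreal (exponential_density (1 / \<mu> i) y)) = (\<lambda>y. ennreal (gamma_kernel (\<mu> i) 1 y * indicator {0..} y))"
    by (auto simp: fun_eq_iff exponential_density_def indicator_def)
  note 2 = d[unfolded this]
  show ?case
    by (rule exI[of _ "gamma_kernel (\<mu> i) 1"], rule exI[of _ "\<lambda>s. 1 / (1 + s * \<mu> i) ^ 1"], intro conjI 1)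
      (use 2 \<open>0 < \<mu> i\<close> in auto)
next
  case (insert i S)
  let ?n = "\<lambda>v. card {j \<in> S. \<mu> j = v}"
  have "indep_vars (\<lambda>_. borel) X S" using insert.prems(1) by (rule indep_vars_subset) auto
  then have "\<exists>f F. gamma_span ?n f F \<and>
    (\<forall>s. (\<forall>i\<in>S. 1 + s * \<mu> i \<noteq> 0) \<longrightarrow> F s = (\<Prod>i\<in>S. 1 / (1 + s * \<mu> i))) \<and>
    (\<forall>y\<ge>0. 0 \<le> f y) \<and>
    distributed M lborel (\<lambda>x. \<Sum>i\<in>S. X i x) (\<lambda>y. ennreal (f y * indicator {0..} y))"
    using insert.prems by (intro insert.IH) auto
  then obtain f F where f: "gamma_span ?n f F \<and>
    (\<forall>s. (\<forall>i\<in>S. 1 + s * \<mu> i \<noteq> 0) \<longrightarrow> F s = (\<Prod>i\<in>S. 1 / (1 + s * \<mu> i))) \<and>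
    (\<forall>y\<ge>0. 0 \<le> f y) \<and>
    distributed M lborel (\<lambda>x. \<Sum>i\<in>S. X i x) (\<lambda>y. ennreal (f y * indicator {0..} y))"
    by (elim exE) (rule that)
  have u: "0 < \<mu> i" using insert by simp
  \<comment> \<open>A value of positive order is the mean of some summand, hence nonzero, and the
    assumed avoidance of poles applies to it.\<close>
  have n0: "v \<in> \<mu> ` S" if "0 < ?n v" for v
  proof -
    have "{j \<in> S. \<mu> j = v} \<noteq> {}" using that by (metis card.empty less_irrefl)
    then show ?thesis by auto
  qed
  have nz: "v \<noteq> 0" if "0 < ?n v" for v
    using n0[OF that] insert.prems(2) by fastforce
  \<comment> \<open>Adding the index \<open>i\<close> raises the multiplicity of
    \<open>\<mu> i\<close> alone, which is exactly the update made by one convolution.\<close>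
  have n': "?n(\<mu> i := Suc (?n (\<mu> i))) = (\<lambda>v. card {j \<in> insert i S. \<mu> j = v})"
  proof
    fix v
    show "(?n(\<mu> i := Suc (?n (\<mu> i)))) v = card {j \<in> insert i S. \<mu> j = v}"
    proof (cases "v = \<mu> i")
      case True
      then have "{j \<in> insert i S. \<mu> j = v} = insert i {j \<in> S. \<mu> j = v}" by auto
      then show ?thesis using True insert by simp
    next
      case False
      then have "{j \<in> insert i S. \<mu> j = v} = {j \<in> S. \<mu> j = v}" by auto
      then show ?thesis using False by simp
    qed
  qed
  from u have "\<mu> i \<noteq> 0" by simp
  then have "\<exists>g G. gamma_span (\<lambda>v. card {j \<in> insert i S. \<mu> j = v}) g G \<and> g 0 = 0 \<and>
    (\<forall>y. (g has_field_derivative (f y - g y) / \<mu> i) (at y)) \<and>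
    (\<forall>s. 1 + s * \<mu> i \<noteq> 0 \<longrightarrow> (\<forall>v. 0 < ?n v \<longrightarrow> 1 + s * v \<noteq> 0) \<longrightarrow> G s = F s / (1 + s * \<mu> i))"
    using nz by (intro gamma_span_convolve_exponential[OF conjunct1[OF f], of "\<mu> i", unfolded n'])
  then obtain g G where g: "gamma_span (\<lambda>v. card {j \<in> insert i S. \<mu> j = v}) g G \<and> g 0 = 0 \<and>
    (\<forall>y. (g has_field_derivative (f y - g y) / \<mu> i) (at y)) \<and>
    (\<forall>s. 1 + s * \<mu> i \<noteq> 0 \<longrightarrow> (\<forall>v. 0 < ?n v \<longrightarrow> 1 + s * v \<noteq> 0) \<longrightarrow> G s = F s / (1 + s * \<mu> i))"
    by (elim exE) (rule that)
  have mf: "f \<in> borel_measurable borel" using f borel_measurable_gamma_span by blast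
  have conv: "0 \<le> y \<Longrightarrow> 0 \<le> g y"
    "(\<integral>\<^sup>+y. ennreal (exponential_density (1 / \<mu> i) (x - y)) * ennreal (f y * indicator {0..} y) \<partial>lborel)
      = ennreal (g x * indicator {0..} x)" for x y
    using convolution_exponential_density[OF u mf, of g] f g by auto
  have G: "G s = (\<Prod>i\<in>insert i S. 1 / (1 + s * \<mu> i))" if s: "\<forall>i\<in>insert i S. 1 + s * \<mu> i \<noteq> 0" for s
  proof -
    have "1 + s * v \<noteq> 0" if "0 < ?n v" for v
      using n0[OF that] s by auto
    then have "G s = F s / (1 + s * \<mu> i)" using g s by blast
    also have "F s = (\<Prod>i\<in>S. 1 / (1 + s * \<mu> i))" using f s by blast
    finally show ?thesis using insert by simp
  qed
  have "distributed M lborel (\<lambda>x. X i x + (\<Sum>i\<in>S. X i x))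
    (\<lambda>x. \<integral>\<^sup>+y. ennreal (exponential_density (1 / \<mu> i) (x - y)) * ennreal (f y * indicator {0..} y) \<partial>lborel)"
    using insert f by (intro distributed_convolution indep_vars_sum) auto
  then have "distributed M lborel (\<lambda>x. \<Sum>i\<in>insert i S. X i x) (\<lambda>y. ennreal (g y * indicator {0..} y))"
    unfolding conv using insert by simp
  then show ?case using g G conv(1)
    by - (rule exI[of _ g], rule exI[of _ G], blast)
qed

section \<open>Identification of the characteristic coefficients\<close>

lemma bij_betw_diag_nth: "bij_betw (diag_nth A) {1..num_distinct A} (diag_elems A)"
proof -
  let ?xs = "rev (sorted_list_of_set (diag_elems A))"
  have fin: "finite (diag_elems A)" by (simp add: diag_elems_def)
  \<comment> \<open>List positions start at 0 and ranks at 1; on \<open>{1..num_distinct A}\<close>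
    the subtraction is never truncated.\<close>
  have "bij_betw (\<lambda>i. i - 1) {1..num_distinct A} {..<length ?xs}"
    by (rule bij_betw_byWitness[where f'=Suc]) (auto simp: num_distinct_def)
  moreover have "bij_betw ((!) ?xs) {..<length ?xs} (diag_elems A)"
    using fin by (intro bij_betw_nth) auto
  ultimately have "bij_betw ((!) ?xs \<circ> (\<lambda>i. i - 1)) {1..num_distinct A} (diag_elems A)"
    by (rule bij_betw_trans)
  then show ?thesis by (simp add: diag_nth_def[abs_def] comp_def)
qed

text \<open>Bridges two indexings: partial fractions are handled by value, characteristic
  coefficients by rank.\<close>

lemma sum_diag_elems_eq:
  "(\<Sum>v\<in>diag_elems A. \<Sum>j=1..card {m. A $ m $ m = v}. h v j)
    = (\<Sum>i=1..num_distinct A. \<Sum>j=1..diag_mult A i. h (diag_nth A i) j)"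
  unfolding diag_mult_def by (rule sum.reindex_bij_betw[OF bij_betw_diag_nth, symmetric])

text \<open>\<open>C\<close> supplies a solution of the identity in the definite description, and
  the difference of two solutions has only zero partial fraction coefficients; so the description
  denotes this solution.\<close>

lemma char_coeff_eq:
  fixes A :: "real^'m::finite^'m" and C :: "real \<Rightarrow> nat \<Rightarrow> real"
  assumes nz: "\<And>m. A $ m $ m \<noteq> 0"
    and C: "\<And>s. (\<forall>m. 1 + s * A $ m $ m \<noteq> 0) \<Longrightarrow> (\<Prod>m\<in>UNIV. 1 / (1 + s * A $ m $ m)) =
      (\<Sum>v\<in>diag_elems A. \<Sum>j=1..card {m. A $ m $ m = v}. C v j / (1 + s * v) ^ j)"
    and ij: "i \<in> {1..num_distinct A}" "j \<in> {1..diag_mult A i}"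
  shows "char_coeff A i j = C (diag_nth A i) j"
proof -
  define c where "c i j = (if i \<in> {1..num_distinct A} \<and> j \<in> {1..diag_mult A i} then C (diag_nth A i) j else 0)" for i j
  have "char_coeff A = c"
    unfolding char_coeff_def
  proof (rule the_equality, intro conjI allI impI)
    fix s assume s: "\<forall>m. 1 + s * A $ m $ m \<noteq> 0"
    show "(\<Prod>m\<in>UNIV. 1 / (1 + s * A $ m $ m)) =
      (\<Sum>i=1..num_distinct A. \<Sum>j=1..diag_mult A i. c i j / (1 + s * diag_nth A i) ^ j)"
      unfolding C[OF s] sum_diag_elems_eq by (intro sum.cong) (simp_all add: c_def)
  next
    fix i j assume "\<not> (i \<in> {1..num_distinct A} \<and> j \<in> {1..diag_mult A i})"
    then show "c i j = 0" unfolding c_def by (simp only: if_False)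
  next
    fix d assume d: "(\<forall>s. (\<forall>m. 1 + s * A $ m $ m \<noteq> 0) \<longrightarrow>
        (\<Prod>m\<in>UNIV. 1 / (1 + s * A $ m $ m)) =
        (\<Sum>i=1..num_distinct A. \<Sum>j=1..diag_mult A i. d i j / (1 + s * diag_nth A i) ^ j)) \<and>
     (\<forall>i j. \<not> (i \<in> {1..num_distinct A} \<and> j \<in> {1..diag_mult A i}) \<longrightarrow> d i j = 0)"
    \<comment> \<open>A competing solution is turned back from ranks to values, so that its
      difference from \<open>C\<close> is a single partial fraction sum.\<close>
    define D where "D v j = d (the_inv_into {1..num_distinct A} (diag_nth A) v) j" for v j
    have inv: "D (diag_nth A i) j = d i j" if "i \<in> {1..num_distinct A}" for i j
      unfolding D_def using bij_betw_diag_nth[of A] that by (simp add: the_inv_into_f_f bij_betw_def)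
    have 0: "C v j - D v j = 0" if "v \<in> diag_elems A" "j \<in> {1..card {m. A $ m $ m = v}}" for v j
    proof (rule partial_fraction_coefficients_zero[where c="\<lambda>v j. C v j - D v j" and V="diag_elems A" and n="\<lambda>v. card {m. A $ m $ m = v}", OF _ _ _ that])
      show "finite (diag_elems A)" "0 \<notin> diag_elems A" using nz by (auto simp: diag_elems_def)
      fix s assume "\<forall>v\<in>diag_elems A. 1 + s * v \<noteq> 0"
      then have s: "\<forall>m. 1 + s * A $ m $ m \<noteq> 0" by (auto simp: diag_elems_def)
      have "(\<Sum>v\<in>diag_elems A. \<Sum>j=1..card {m. A $ m $ m = v}. D v j / (1 + s * v) ^ j)
        = (\<Sum>i=1..num_distinct A. \<Sum>j=1..diag_mult A i. d i j / (1 + s * diag_nth A i) ^ j)"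
        unfolding sum_diag_elems_eq by (intro sum.cong) (simp_all add: inv)
      also have "\<dots> = (\<Sum>v\<in>diag_elems A. \<Sum>j=1..card {m. A $ m $ m = v}. C v j / (1 + s * v) ^ j)"
        using d s C[OF s] by simp
      finally show "(\<Sum>v\<in>diag_elems A. \<Sum>j=1..card {m. A $ m $ m = v}. (C v j - D v j) / (1 + s * v) ^ j) = 0"
        by (simp add: diff_divide_distrib sum_subtractf)
    qed
    show "d = c"
    proof (intro ext)
      fix i j
      show "d i j = c i j"
      proof (cases "i \<in> {1..num_distinct A} \<and> j \<in> {1..diag_mult A i}")
        case True
        then have "diag_nth A i \<in> diag_elems A" using bij_betw_diag_nth[of A] by (auto simp: bij_betw_def)
        then have "C (diag_nth A i) j - D (diag_nth A i) j = 0" using True by (intro 0) (auto simp: diag_mult_def)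
        then show ?thesis using True inv by (simp add: c_def)
      next
        case False
        show ?thesis unfolding c_def using False d[THEN conjunct2, rule_format, OF False] by (simp only: if_False)
      qed
    qed
  qed
  then show ?thesis using ij by (simp add: c_def)
qed

subsection \<open>Generalized incomplete Gamma integrals\<close>

text \<open>Substitute \<open>u = b * n\<close>: the power \<open>n ^ m\<close> and the Jacobian
  together give \<open>1 / b ^ Suc m\<close>, and \<open>t / (g * n)\<close> becomes
  \<open>(b * t / g) / u\<close>.\<close>

lemma has_bochner_integral_gen_inc_Gamma:
  fixes b t g :: real
  assumes b: "0 < b" and t: "0 < t" and g: "0 < g"
  shows "has_bochner_integral lborel (\<lambda>n. indicator {t..} n * (n ^ m * exp (- b * n - t / (g * n))))
    (gen_inc_Gamma (real m + 1) (b * t) (b * t / g) / b ^ Suc m)"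
proof -
  define h where "h u = indicator {b * t..} u * (u ^ m * exp (- u - b * t / g / u))" for u
  \<comment> \<open>The dominating function: on the range of integration the remaining factor
    \<open>exp (- b * t / g / u)\<close> is at most 1.\<close>
  have hb: "has_bochner_integral lborel (\<lambda>u::real. u ^ m * exp (- u) * indicator {0..} u) (fact m)"
  proof (rule has_bochner_integral_nn_integral)
    have "(\<integral>\<^sup>+ u. ennreal (u ^ m * exp (- u) * indicator {0..} u) \<partial>lborel)
      = (\<integral>\<^sup>+ u. ennreal (u ^ m * exp (- u)) * indicator {0..} u \<partial>lborel)"
      by (intro nn_integral_cong) (simp add: indicator_def)
    also have "\<dots> = ennreal (fact m)"
      by (subst nn_intergal_power_times_exp_Ici) simp
    finally show "(\<integral>\<^sup>+ u. ennreal (u ^ m * exp (- u) * indicator {0..} u) \<partial>lborel) = ennreal (fact m)" .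
  qed (auto simp: indicator_def)
  have "integrable lborel h"
  proof (rule Bochner_Integration.integrable_bound[OF integrable.intros[OF hb]])
    show "h \<in> borel_measurable lborel" unfolding h_def by measurable
    show "AE u in lborel. norm (h u) \<le> norm (u ^ m * exp (- u) * indicator {0..} u)"
    proof (rule AE_I2)
      fix u
      show "norm (h u) \<le> norm (u ^ m * exp (- u) * indicator {0..} u)"
      proof (cases "b * t \<le> u")
        case True
        then have u: "0 < u" using b t by (meson less_le_trans mult_pos_pos)
        then have "exp (- u - b * t / g / u) \<le> exp (- u)" using b t g by simp
        then show ?thesis using True u by (simp add: h_def abs_mult mult_left_mono)
      qed (simp add: h_def)
    qed
  qed
  moreover have "integral\<^sup>L lborel h = gen_inc_Gamma (real m + 1) (b * t) (b * t / g)"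
    unfolding gen_inc_Gamma_def set_lebesgue_integral_def
  proof (rule Bochner_Integration.integral_cong, simp)
    fix u :: real
    show "h u = indicator {b * t..} u *\<^sub>R (u powr (real m + 1 - 1) * exp (- u - b * t / g / u))"
    proof (cases "b * t \<le> u")
      case True
      then have "0 < u" using b t by (meson less_le_trans mult_pos_pos)
      then show ?thesis by (simp add: h_def powr_realpow)
    qed (simp add: h_def)
  qed
  ultimately have "has_bochner_integral lborel h (gen_inc_Gamma (real m + 1) (b * t) (b * t / g))"
    by (simp add: has_bochner_integral_iff)
  then have "has_bochner_integral lborel (\<lambda>n. h (0 + b * n)) (gen_inc_Gamma (real m + 1) (b * t) (b * t / g) /\<^sub>R \<bar>b\<bar>)"
    using b by (subst (asm) lborel_has_bochner_integral_real_affine_iff[of b _ _ 0]) auto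
  then have "has_bochner_integral lborel (\<lambda>n. (1 / b ^ m) * h (0 + b * n))
    ((1 / b ^ m) * (gen_inc_Gamma (real m + 1) (b * t) (b * t / g) /\<^sub>R \<bar>b\<bar>))"
    by (rule has_bochner_integral_mult_right)
  also have "(\<lambda>n. (1 / b ^ m) * h (0 + b * n)) = (\<lambda>n. indicator {t..} n * (n ^ m * exp (- b * n - t / (g * n))))"
  proof
    fix n
    show "(1 / b ^ m) * h (0 + b * n) = indicator {t..} n * (n ^ m * exp (- b * n - t / (g * n)))"
      using b g by (simp add: h_def indicator_def power_mult_distrib)
  qed
  also have "(1 / b ^ m) * (gen_inc_Gamma (real m + 1) (b * t) (b * t / g) /\<^sub>R \<bar>b\<bar>)
    = gen_inc_Gamma (real m + 1) (b * t) (b * t / g) / b ^ Suc m"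
    using b by (simp add: field_simps)
  finally show ?thesis .
qed

section \<open>The tilted distribution function and its integral\<close>

text \<open>For \<open>1 \<le> j\<close> and positive \<open>v \<noteq> g\<close>, this is the
  closed form of the integral of \<open>gamma_kernel v j z * exp (z / g)\<close> over
  \<open>z\<close> from 0 to \<open>y\<close>: up to its prefactor, an Erlang distribution function
  of rate \<open>1 / v - 1 / g\<close>. The rate is negative when \<open>g < v\<close>, and the
  closed form remains valid.\<close>

definition tilted_gamma_cdf :: "real \<Rightarrow> real \<Rightarrow> nat \<Rightarrow> real \<Rightarrow> real" where
  "tilted_gamma_cdf v g j y = (1 - v / g) powi (- int j) *
    (1 - exp (- (1 / v - 1 / g) * y) * (\<Sum>k=0..j-1. ((1 / v - 1 / g) * y) ^ k / fact k))"

text \<open>The derivative telescopes: the positive part contributed by each new term cancels what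
  the lower orders left, so only the negative part of the last term remains.\<close>

lemma has_field_derivative_exp_partial_sum:
  fixes a y :: real
  shows "((\<lambda>y. exp (- a * y) * (\<Sum>k=0..j. (a * y) ^ k / fact k)) has_field_derivative
    - a * (a * y) ^ j * exp (- a * y) / fact j) (at y)"
proof (induction j)
  case 0
  show ?case by (auto intro!: derivative_eq_intros)
next
  case (Suc j)
  have f: "fact (Suc j) = real (Suc j) * fact j" by simp
  have "((\<lambda>y. exp (- a * y) * ((a * y) ^ Suc j / fact (Suc j))) has_field_derivative
    exp (- a * y) * (real (Suc j) * (a * y) ^ j * a / fact (Suc j)) + (exp (- a * y) * (- a)) * ((a * y) ^ Suc j / fact (Suc j))) (at y)"
    by (auto intro!: derivative_eq_intros simp del: power_Suc fact_Suc)
      (simp add: diff_divide_distrib mult_ac del: power_Suc fact_Suc)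
  also have "exp (- a * y) * (real (Suc j) * (a * y) ^ j * a / fact (Suc j)) = a * (a * y) ^ j * exp (- a * y) / fact j"
    unfolding f by (simp del: of_nat_Suc)
  finally have "((\<lambda>y. exp (- a * y) * ((a * y) ^ Suc j / fact (Suc j))) has_field_derivative
    a * (a * y) ^ j * exp (- a * y) / fact j + (exp (- a * y) * (- a)) * ((a * y) ^ Suc j / fact (Suc j))) (at y)" .
  from DERIV_add[OF Suc this] show ?case
    by (simp add: distrib_left mult.assoc mult.left_commute[of a] mult.commute[of "exp _"] del: power_Suc fact_Suc)
qed

lemma tilted_gamma_cdf_0: "1 \<le> j \<Longrightarrow> tilted_gamma_cdf v g j 0 = 0"
proof -
  have "(\<Sum>k=0..n. (0::real) ^ k / fact k) = 1" for n
    by (induction n) auto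
  then show "tilted_gamma_cdf v g j 0 = 0" by (simp add: tilted_gamma_cdf_def)
qed

text \<open>With \<open>y = (n - t) / (1 + t)\<close>, \<open>a * y\<close> equals
  \<open>(- a * t / (1 + t)) * (1 - n / t)\<close>. Expanding \<open>(1 - n / t) ^ k\<close>
  binomially leaves powers of \<open>n\<close>, and \<open>exp (- n / g) * exp (- a * y)\<close>
  merges into \<open>exp (a * t / (1 + t)) * exp (- b * n)\<close>.\<close>

lemma has_bochner_integral_tilted_gamma_cdf:
  fixes v g h t a b :: real
  assumes v: "0 < v" "0 < g" "v \<noteq> g" and h: "0 < h" and t: "0 < t"
    and a_def: "a = 1 / v - 1 / g" and b_def: "b = 1 / g + a / (1 + t)"
  shows "has_bochner_integral lborel
    (\<lambda>n. indicator {t..} n * (1 / g * exp (- n / g - t / (h * n)) * tilted_gamma_cdf v g j ((n - t) / (1 + t))))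
    ((1 - v / g) powi (- int j) *
      (gen_inc_Gamma 1 (t / g) (t / (g * h))
       - 1 / g * exp (a * t / (1 + t)) *
         (\<Sum>k=0..j-1. 1 / fact k * (- a * t / (1 + t)) ^ k *
           (\<Sum>m=0..k. real (k choose m) * (inverse b / (- b * t) ^ m) *
             gen_inc_Gamma (real m + 1) (b * t) (b * t / h)))))"
proof -
  \<comment> \<open>\<open>b\<close> is positive even if \<open>a\<close> is negative, as the form
    \<open>(t / g + 1 / v) / (1 + t)\<close> shows.\<close>
  have "1 / g = 1 / g * (1 + t) / (1 + t)" using t by simp
  then have "b = (1 / g * (1 + t) + a) / (1 + t)" unfolding b_def add_divide_distrib by (rule arg_cong)
  also have "1 / g * (1 + t) + a = t / g + 1 / v" by (simp add: a_def algebra_simps add_divide_distrib)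
  finally have "b = (t / g + 1 / v) / (1 + t)" .
  then have b: "0 < b" using t v by (simp add: add_pos_pos)
  \<comment> \<open>\<open>T m\<close> are the terms of the binomial expansion, at rate
    \<open>b\<close>; \<open>T0\<close> comes from the constant 1 in \<open>tilted_gamma_cdf\<close>
    and keeps the rate \<open>1 / g\<close>.\<close>
  define T where "T m n = indicator {t..} n * (n ^ m * exp (- b * n - t / (h * n)))" for m and n :: real
  define T0 where "T0 n = indicator {t..} n * (n ^ 0 * exp (- (1 / g) * n - t / (h * n)))" for n :: real
  define G where "G m = gen_inc_Gamma (real m + 1) (b * t) (b * t / h)" for m
  have T: "has_bochner_integral lborel (T m) (G m / b ^ Suc m)" for m
    unfolding T_def G_def using b t h by (rule has_bochner_integral_gen_inc_Gamma)
  have T0: "has_bochner_integral lborel T0 (gen_inc_Gamma 1 (t / g) (t / (g * h)) * g)"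
    unfolding T0_def using has_bochner_integral_gen_inc_Gamma[of "1 / g" t h 0] v t h by simp
  have "has_bochner_integral lborel
    (\<lambda>n. (1 - v / g) powi (- int j) * (1 / g * T0 n - 1 / g * exp (a * t / (1 + t)) *
      (\<Sum>k=0..j-1. 1 / fact k * (- a * t / (1 + t)) ^ k * (\<Sum>m=0..k. real (k choose m) * (- 1 / t) ^ m * T m n))))
    ((1 - v / g) powi (- int j) * (1 / g * (gen_inc_Gamma 1 (t / g) (t / (g * h)) * g) - 1 / g * exp (a * t / (1 + t)) *
      (\<Sum>k=0..j-1. 1 / fact k * (- a * t / (1 + t)) ^ k * (\<Sum>m=0..k. real (k choose m) * (- 1 / t) ^ m * (G m / b ^ Suc m)))))"
    by (intro has_bochner_integral_mult_right has_bochner_integral_diff has_bochner_integral_sum T T0)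
  also have "(\<lambda>n. (1 - v / g) powi (- int j) * (1 / g * T0 n - 1 / g * exp (a * t / (1 + t)) *
      (\<Sum>k=0..j-1. 1 / fact k * (- a * t / (1 + t)) ^ k * (\<Sum>m=0..k. real (k choose m) * (- 1 / t) ^ m * T m n))))
    = (\<lambda>n. indicator {t..} n * (1 / g * exp (- n / g - t / (h * n)) * tilted_gamma_cdf v g j ((n - t) / (1 + t))))"
  proof
    fix n
    have bin: "(\<Sum>m=0..k. real (k choose m) * (- 1 / t) ^ m * T m n)
      = indicator {t..} n * exp (- b * n - t / (h * n)) * (1 - n / t) ^ k" for k
    proof -
      have "(1 - n / t) ^ k = (- n / t + 1) ^ k" by simp
      also have "\<dots> = (\<Sum>m\<le>k. real (k choose m) * (- n / t) ^ m)"
        by (subst binomial_ring) simp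
      also have "\<dots> = (\<Sum>m=0..k. real (k choose m) * (- 1 / t) ^ m * n ^ m)"
        unfolding atMost_atLeast0
      proof (rule sum.cong, simp)
        fix m
        have "(- n / t) ^ m = (- 1 / t) ^ m * n ^ m" by (subst power_mult_distrib[symmetric]) simp
        then show "real (k choose m) * (- n / t) ^ m = real (k choose m) * (- 1 / t) ^ m * n ^ m" by simp
      qed
      finally show ?thesis unfolding T_def by (simp add: sum_distrib_left mult_ac)
    qed
    have aY: "(- a * t / (1 + t)) ^ k * (1 - n / t) ^ k = (a * ((n - t) / (1 + t))) ^ k" for k
    proof -
      have "(- a * t / (1 + t)) * (1 - n / t) = a * ((n - t) / (1 + t))"
      proof -
        have e: "t * (1 - n / t) = t - n" using t by (simp add: right_diff_distrib)
        have "(- a * t / (1 + t)) * (1 - n / t) = - a / (1 + t) * (t * (1 - n / t))"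
          by (simp only: times_divide_eq_left times_divide_eq_right mult.assoc)
        also have "\<dots> = a * ((n - t) / (1 + t))"
          unfolding e by (simp add: algebra_simps diff_divide_distrib)
        finally show ?thesis .
      qed
      then show ?thesis by (simp only: power_mult_distrib[symmetric])
    qed
    have ex: "exp (a * t / (1 + t)) * exp (- b * n - t / (h * n))
      = exp (- n / g - t / (h * n)) * exp (- a * ((n - t) / (1 + t)))"
    proof -
      have "a * t / (1 + t) + (- b * n - t / (h * n)) = (- n / g - t / (h * n)) + (- a * ((n - t) / (1 + t)))"
        unfolding b_def by (simp add: algebra_simps add_divide_distrib diff_divide_distrib)
      then show ?thesis by (simp only: exp_add[symmetric])
    qed
    have "(\<Sum>k=0..j-1. 1 / fact k * (- a * t / (1 + t)) ^ k * (\<Sum>m=0..k. real (k choose m) * (- 1 / t) ^ m * T m n))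
      = (\<Sum>k=0..j-1. indicator {t..} n * exp (- b * n - t / (h * n)) * ((a * ((n - t) / (1 + t))) ^ k / fact k))"
      unfolding bin aY[symmetric] by (intro sum.cong) simp_all
    also have "\<dots> = indicator {t..} n * exp (- b * n - t / (h * n)) * (\<Sum>k=0..j-1. (a * ((n - t) / (1 + t))) ^ k / fact k)"
      by (simp only: sum_distrib_left)
    finally have *: "exp (a * t / (1 + t)) *
      (\<Sum>k=0..j-1. 1 / fact k * (- a * t / (1 + t)) ^ k * (\<Sum>m=0..k. real (k choose m) * (- 1 / t) ^ m * T m n))
      = indicator {t..} n * (exp (a * t / (1 + t)) * exp (- b * n - t / (h * n))) * (\<Sum>k=0..j-1. (a * ((n - t) / (1 + t))) ^ k / fact k)"
      by (simp only: mult_ac)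
    show "(1 - v / g) powi (- int j) * (1 / g * T0 n - 1 / g * exp (a * t / (1 + t)) *
      (\<Sum>k=0..j-1. 1 / fact k * (- a * t / (1 + t)) ^ k * (\<Sum>m=0..k. real (k choose m) * (- 1 / t) ^ m * T m n)))
    = indicator {t..} n * (1 / g * exp (- n / g - t / (h * n)) * tilted_gamma_cdf v g j ((n - t) / (1 + t)))"
      unfolding mult.assoc[of "1 / g" "exp (a * t / (1 + t))"] * ex tilted_gamma_cdf_def a_def[symmetric] T0_def
      by (simp add: algebra_simps)
  qed
  also have "1 / g * (gen_inc_Gamma 1 (t / g) (t / (g * h)) * g) = gen_inc_Gamma 1 (t / g) (t / (g * h))"
    using v by simp
  finally have main: "has_bochner_integral lborel
    (\<lambda>n. indicator {t..} n * (1 / g * exp (- n / g - t / (h * n)) * tilted_gamma_cdf v g j ((n - t) / (1 + t))))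
    ((1 - v / g) powi (- int j) * (gen_inc_Gamma 1 (t / g) (t / (g * h)) - 1 / g * exp (a * t / (1 + t)) *
      (\<Sum>k=0..j-1. 1 / fact k * (- a * t / (1 + t)) ^ k * (\<Sum>m=0..k. real (k choose m) * (- 1 / t) ^ m * (G m / b ^ Suc m)))))" .
  \<comment> \<open>Merges the binomial factor \<open>(- 1 / t) ^ m\<close> with the scaling
    \<open>b ^ Suc m\<close>.\<close>
  have "real (k choose m) * (- 1 / t) ^ m * (G m / b ^ Suc m) = real (k choose m) * (inverse b / (- b * t) ^ m) * G m" for k m
  proof -
    have "(- b * t) ^ m = b ^ m * (- t) ^ m" by (simp add: power_mult_distrib[symmetric])
    moreover have "(- 1 / t) ^ m = 1 / (- t) ^ m"
      by (metis divide_minus_right minus_divide_left power_one_over)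
    ultimately show ?thesis
      using b by (simp add: field_simps)
  qed
  with main show ?thesis unfolding G_def by simp
qed

text \<open>With \<open>a = 1 / v - 1 / g\<close>, the telescoped derivative carries
  \<open>a ^ j\<close>, which cancels against \<open>(1 - v / g) ^ j = (v * a) ^ j\<close>;
  \<open>v \<noteq> g\<close> keeps \<open>a\<close> nonzero. Splitting \<open>exp (- a * y)\<close>
  produces the tilt.\<close>

lemma has_field_derivative_tilted_gamma_cdf:
  assumes "v \<noteq> 0" "g \<noteq> 0" "v \<noteq> g" "1 \<le> j"
  shows "(tilted_gamma_cdf v g j has_field_derivative gamma_kernel v j y * exp (y / g)) (at y)"
proof -
  obtain k where j: "j = Suc k" using assms(4) by (cases j) auto
  define a where "a = 1 / v - 1 / g"
  have va: "1 - v / g = v * a" using assms by (simp add: a_def right_diff_distrib)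
  have a: "a \<noteq> 0" using assms by (simp add: a_def)
  have "(tilted_gamma_cdf v g j has_field_derivative
    (v * a) powi (- int j) * (0 - (- a * (a * y) ^ k * exp (- a * y) / fact k))) (at y)"
    unfolding tilted_gamma_cdf_def[abs_def] va a_def[symmetric] j diff_Suc_1
    by (intro DERIV_cmult DERIV_diff DERIV_const has_field_derivative_exp_partial_sum)
  also have "(v * a) powi (- int j) * (0 - (- a * (a * y) ^ k * exp (- a * y) / fact k)) = gamma_kernel v j y * exp (y / g)"
  proof -
    have "exp (- a * y) = exp (- y / v) * exp (y / g)"
      unfolding exp_add[symmetric] a_def by (simp add: algebra_simps)
    moreover have "(v * a) powi (- int j) = 1 / (v ^ Suc k * a ^ Suc k)"
      by (simp only: power_int_minus power_int_of_nat j power_mult_distrib inverse_eq_divide)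
    ultimately show ?thesis using a assms(1)
      by (simp add: j power_mult_distrib)
  qed
  finally show ?thesis .
qed

subsection \<open>The success probability\<close>

text \<open>The integral is read as a probability for \<open>W\<close>, whose exponential tail is
  known.\<close>

lemma (in prob_space) exponential_tail_nn_integral:
  assumes "0 < h" "distributed M lborel W (exponential_density (1 / h))" "0 \<le> c"
  shows "(\<integral>\<^sup>+w. ennreal (exponential_density (1 / h) w) * indicator {c<..} w \<partial>lborel) = ennreal (exp (- c / h))"
proof -
  have "(\<integral>\<^sup>+w. ennreal (exponential_density (1 / h) w) * indicator {c<..} w \<partial>lborel)
    = emeasure M (W -` {c<..} \<inter> space M)"
    using assms(2) by (intro distributed_emeasure[symmetric]) auto
  also have "W -` {c<..} \<inter> space M = {x \<in> space M. c < W x}" by auto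
  also have "emeasure M \<dots> = ennreal (exp (- c / h))"
    using exponential_distributedD_gt[OF assms(2,3)] assms(1) by (simp add: emeasure_eq_measure)
  finally show ?thesis .
qed

text \<open>Independence is put as a factorization of the joint law because the images may have
  different types: it is applied to the pair of interference and \<open>\<gamma>\<^sub>h\<close>
  against the single variable \<open>W\<close>.\<close>

lemma (in prob_space) indep_var_compose_distr_pair:
  assumes "indep_var M1 X M2 Y" and [measurable]: "f \<in> measurable M1 N1" "g \<in> measurable M2 N2"
  shows "distr M N1 (\<lambda>x. f (X x)) \<Otimes>\<^sub>M distr M N2 (\<lambda>x. g (Y x))
    = distr M (N1 \<Otimes>\<^sub>M N2) (\<lambda>x. (f (X x), g (Y x)))"
proof -
  have [measurable]: "X \<in> measurable M M1" "Y \<in> measurable M M2"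
    using indep_var_rv1[OF assms(1)] indep_var_rv2[OF assms(1)] .
  interpret X: prob_space "distr M M1 X" by (rule prob_space_distr) simp
  interpret Y: prob_space "distr M M2 Y" by (rule prob_space_distr) simp
  interpret Y': prob_space "distr (distr M M2 Y) N2 g" by (rule Y.prob_space_distr) simp
  have "distr M N1 (\<lambda>x. f (X x)) \<Otimes>\<^sub>M distr M N2 (\<lambda>x. g (Y x))
    = distr (distr M M1 X) N1 f \<Otimes>\<^sub>M distr (distr M M2 Y) N2 g"
    by (simp add: distr_distr comp_def)
  also have "\<dots> = distr (distr M M1 X \<Otimes>\<^sub>M distr M M2 Y) (N1 \<Otimes>\<^sub>M N2) (\<lambda>(x, y). (f x, g y))"
    by (rule pair_measure_distr) (simp_all add: Y'.sigma_finite_measure_axioms)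
  also have "distr M M1 X \<Otimes>\<^sub>M distr M M2 Y = distr M (M1 \<Otimes>\<^sub>M M2) (\<lambda>x. (X x, Y x))"
    using indep_var_distribution_eq[of M1 X M2 Y] assms(1) by simp
  finally show ?thesis by (simp add: distr_distr comp_def)
qed

text \<open>
  The tilting factor \<open>exp (y / g)\<close> appears because, for a given total power
  \<open>n = H x + I x\<close>, the exponential density of \<open>H\<close> contributes \<open>exp (- (n - y) / g)\<close>.
\<close>

lemma (in prob_space) relay_success_prob:
  fixes H I W :: "'a \<Rightarrow> real" and f \<Phi> :: "real \<Rightarrow> real"
  assumes pos: "0 < g" "0 < h" "0 < t"
    and H: "distributed M lborel H (exponential_density (1 / g))"
    and W: "distributed M lborel W (exponential_density (1 / h))"
    and I: "distributed M lborel I (\<lambda>y. ennreal (f y * indicator {0..} y))"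
    and f [measurable]: "f \<in> borel_measurable borel" and f_nonneg: "\<And>y. 0 \<le> y \<Longrightarrow> 0 \<le> f y"
    and IH: "indep_var lborel I lborel H"
    and IHW: "distr M (lborel \<Otimes>\<^sub>M lborel) (\<lambda>x. (I x, H x)) \<Otimes>\<^sub>M distr M lborel W
      = distr M ((lborel \<Otimes>\<^sub>M lborel) \<Otimes>\<^sub>M lborel) (\<lambda>x. ((I x, H x), W x))"
    and \<Phi>: "\<Phi> 0 = 0" "\<And>y. (\<Phi> has_field_derivative f y * exp (y / g)) (at y)"
    and Q: "has_bochner_integral lborel
      (\<lambda>n. indicator {t..} n * (1 / g * exp (- n / g - t / (h * n)) * \<Phi> ((n - t) / (1 + t)))) Q"
  shows "measure M {x \<in> space M. H x / (1 + I x) > t \<and> W x * (H x + I x) > t} = Q"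
proof -
  \<comment> \<open>Nonnegativity of the final integrand lets the extended nonnegative integral be
    read as the Bochner integral \<open>Q\<close>.\<close>
  have "0 \<le> \<Phi> y" if "0 \<le> y" for y
  proof -
    have "\<Phi> 0 \<le> \<Phi> y"
      using that \<Phi>(2) f_nonneg by (intro DERIV_nonneg_imp_nondecreasing[of 0 y \<Phi>]) fastforce+
    then show ?thesis using \<Phi>(1) by simp
  qed
  then have nonneg: "0 \<le> indicator {t..} n * (1 / g * exp (- n / g - t / (h * n)) * \<Phi> ((n - t) / (1 + t)))" for n
    using pos by (auto simp: indicator_def)
  define S :: "((real \<times> real) \<times> real) set"
    where "S = {z. snd (fst z) / (1 + fst (fst z)) > t \<and> snd z * (snd (fst z) + fst (fst z)) > t}"
  have "Measurable.pred ((borel \<Otimes>\<^sub>M borel) \<Otimes>\<^sub>M borel)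
      (\<lambda>z::(real \<times> real) \<times> real. snd (fst z) / (1 + fst (fst z)) > t \<and> snd z * (snd (fst z) + fst (fst z)) > t)"
    by measurable
  then have S [measurable]: "S \<in> sets ((borel \<Otimes>\<^sub>M borel) \<Otimes>\<^sub>M borel)"
    unfolding S_def pred_def by (simp add: space_pair_measure)
  let ?fI = "\<lambda>y. ennreal (f y * indicator {0..} y)" and ?fH = "\<lambda>x. ennreal (exponential_density (1 / g) x)"
    and ?fW = "\<lambda>w. ennreal (exponential_density (1 / h) w)"
  have sf: "sigma_finite_measure (lborel :: real measure)" by (rule lborel.sigma_finite_measure_axioms)
  have sf2: "sigma_finite_measure (lborel \<Otimes>\<^sub>M lborel :: (real \<times> real) measure)"
    unfolding lborel_prod by (rule lborel.sigma_finite_measure_axioms)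
  have "distributed M ((lborel \<Otimes>\<^sub>M lborel) \<Otimes>\<^sub>M lborel) (\<lambda>x. ((I x, H x), W x)) (\<lambda>(p, w). (\<lambda>(y, x). ?fI y * ?fH x) p * ?fW w)"
    by (intro distributed_joint_indep'[OF sf2 sf distributed_joint_indep[OF sf sf I H IH] W IHW])
  moreover have S': "S \<in> sets ((lborel \<Otimes>\<^sub>M lborel) \<Otimes>\<^sub>M lborel)"
    using S by (simp cong: sets_pair_measure_cong)
  ultimately have "emeasure M ((\<lambda>x. ((I x, H x), W x)) -` S \<inter> space M)
    = (\<integral>\<^sup>+z. (\<lambda>(p, w). (\<lambda>(y, x). ?fI y * ?fH x) p * ?fW w) z * indicator S z \<partial>((lborel \<Otimes>\<^sub>M lborel) \<Otimes>\<^sub>M lborel))"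
    by (rule distributed_emeasure)
  also have "\<dots> = (\<integral>\<^sup>+p. \<integral>\<^sup>+w. (\<lambda>(y, x). ?fI y * ?fH x) p * ?fW w * indicator S (p, w) \<partial>lborel \<partial>(lborel \<Otimes>\<^sub>M lborel))"
    by (subst lborel.nn_integral_fst[symmetric]) (auto simp: split_beta')
  also have "\<dots> = (\<integral>\<^sup>+y. \<integral>\<^sup>+x. \<integral>\<^sup>+w. ?fI y * ?fH x * ?fW w * indicator S ((y, x), w) \<partial>lborel \<partial>lborel \<partial>lborel)"
    by (subst lborel.nn_integral_fst[symmetric]) (auto simp: split_beta')
  \<comment> \<open>\<open>W\<close> is integrated out first: once \<open>t * (1 + y) < x\<close>
    holds with \<open>0 \<le> y\<close>, the other condition is \<open>w > t / (x + y)\<close>, an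
    exponential tail.\<close>
  also have "\<dots> = (\<integral>\<^sup>+y. \<integral>\<^sup>+x. ?fI y * ?fH x * indicator {z. t * (1 + y) < z} x * ennreal (exp (- t / (h * (x + y)))) \<partial>lborel \<partial>lborel)"
  proof (intro nn_integral_cong)
    fix y x :: real
    show "(\<integral>\<^sup>+w. ?fI y * ?fH x * ?fW w * indicator S ((y, x), w) \<partial>lborel)
      = ?fI y * ?fH x * indicator {z. t * (1 + y) < z} x * ennreal (exp (- t / (h * (x + y))))"
    proof (cases "0 \<le> y \<and> t * (1 + y) < x")
      case True
      have "0 \<le> t * (1 + y)" using True pos by simp
      then have xy: "0 < x + y" using True by linarith
      have "?fI y * ?fH x * ?fW w * indicator S ((y, x), w) = ?fI y * ?fH x * (?fW w * indicator {t / (x + y)<..} w)" for w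
        using True xy by (auto simp: S_def indicator_def field_simps)
      then have "(\<integral>\<^sup>+w. ?fI y * ?fH x * ?fW w * indicator S ((y, x), w) \<partial>lborel)
        = ?fI y * ?fH x * (\<integral>\<^sup>+w. ?fW w * indicator {t / (x + y)<..} w \<partial>lborel)"
        by (simp only: nn_integral_cmult) (subst nn_integral_cmult, auto)
      also have "(\<integral>\<^sup>+w. ?fW w * indicator {t / (x + y)<..} w \<partial>lborel) = ennreal (exp (- (t / (x + y)) / h))"
        using pos xy by (intro exponential_tail_nn_integral[OF pos(2) W]) auto
      finally show ?thesis using True by (simp add: mult.commute)
    next
      case False
      have "?fI y * ?fH x * ?fW w * indicator S ((y, x), w) = 0" for w
      proof (cases "0 \<le> y")
        case True
        then show ?thesis using False by (auto simp: S_def indicator_def field_simps)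
      qed simp
      moreover have "?fI y * ?fH x * indicator {z. t * (1 + y) < z} x = 0"
        using False by (cases "0 \<le> y") auto
      ultimately show ?thesis by (simp only: nn_integral_const) simp
    qed
  qed
  \<comment> \<open>The translation \<open>n = x + y\<close> makes the tail depend on
    \<open>n\<close> alone, so that it factors out of the inner integral once the order of
    integration is swapped.\<close>
  also have "\<dots> = (\<integral>\<^sup>+y. \<integral>\<^sup>+n. ?fI y * ?fH (n - y) * indicator {z. t * (1 + y) < z} (n - y) * ennreal (exp (- t / (h * n))) \<partial>lborel \<partial>lborel)"
  proof (rule nn_integral_cong)
    fix y :: real
    show "(\<integral>\<^sup>+x. ?fI y * ?fH x * indicator {z. t * (1 + y) < z} x * ennreal (exp (- t / (h * (x + y)))) \<partial>lborel)
      = (\<integral>\<^sup>+n. ?fI y * ?fH (n - y) * indicator {z. t * (1 + y) < z} (n - y) * ennreal (exp (- t / (h * n))) \<partial>lborel)"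
      by (subst nn_integral_real_affine[where c=1 and t="-y"]) auto
  qed
  also have "\<dots> = (\<integral>\<^sup>+n. \<integral>\<^sup>+y. ?fI y * ?fH (n - y) * indicator {z. t * (1 + y) < z} (n - y) * ennreal (exp (- t / (h * n))) \<partial>lborel \<partial>lborel)"
    by (rule lborel_pair.Fubini') (simp add: indicator_def of_bool_def split_beta')
  also have "\<dots> = (\<integral>\<^sup>+n. ennreal (indicator {t..} n * (1 / g * exp (- n / g - t / (h * n)) * \<Phi> ((n - t) / (1 + t)))) \<partial>lborel)"
  proof (intro nn_integral_cong)
    fix n :: real
    let ?Y = "(n - t) / (1 + t)" and ?K = "1 / g * exp (- n / g - t / (h * n))"
    have Y: "t * (1 + y) < n - y \<longleftrightarrow> y < ?Y" for y using pos by (simp add: field_simps)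
    have "(\<integral>\<^sup>+y. ?fI y * ?fH (n - y) * indicator {z. t * (1 + y) < z} (n - y) * ennreal (exp (- t / (h * n))) \<partial>lborel)
      = (\<integral>\<^sup>+y. ennreal ?K * (ennreal (f y * exp (y / g)) * indicator {0..?Y} y) \<partial>lborel)"
    \<comment> \<open>The event has the strict bound \<open>y < ?Y\<close>, the fundamental theorem
      needs the closed interval; the endpoint is a null set.\<close>
    proof (rule nn_integral_cong_AE, rule AE_mp[OF AE_lborel_singleton[of ?Y]], rule AE_I2, intro impI)
      fix y assume y: "y \<noteq> ?Y"
      show "?fI y * ?fH (n - y) * indicator {z. t * (1 + y) < z} (n - y) * ennreal (exp (- t / (h * n)))
        = ennreal ?K * (ennreal (f y * exp (y / g)) * indicator {0..?Y} y)"
      proof (cases "0 \<le> y \<and> y < ?Y")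
        case True
        have "0 \<le> t * (1 + y)" using True pos by simp
        then have ny: "0 < n - y" using True Y[of y] by linarith
        have "?fI y * ?fH (n - y) * indicator {z. t * (1 + y) < z} (n - y) * ennreal (exp (- t / (h * n)))
          = ennreal (f y) * ennreal (1 / g * exp (- (n - y) / g)) * ennreal (exp (- t / (h * n)))"
          using True ny Y[of y] by (simp add: exponential_density_def)
        also have "\<dots> = ennreal (f y * (1 / g * exp (- (n - y) / g)) * exp (- t / (h * n)))"
        proof -
          have 1: "0 \<le> f y" using True f_nonneg by simp
          then have 2: "0 \<le> f y * (1 / g * exp (- (n - y) / g))" using pos by simp
          show ?thesis by (simp only: ennreal_mult'[OF 1] ennreal_mult'[OF 2])
        qed
        also have "exp (- (n - y) / g) = exp (- n / g) * exp (y / g)"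
          by (simp add: exp_add[symmetric] diff_divide_distrib)
        also have "f y * (1 / g * (exp (- n / g) * exp (y / g))) * exp (- t / (h * n)) = ?K * (f y * exp (y / g))"
          by (simp add: exp_diff exp_minus field_simps)
        also have "ennreal \<dots> = ennreal ?K * ennreal (f y * exp (y / g))"
          using pos f_nonneg[of y] True by (intro ennreal_mult) auto
        finally show ?thesis using True by simp
      next
        case False
        then show ?thesis using y Y[of y] by (auto simp: indicator_def)
      qed
    qed
    also have "\<dots> = ennreal ?K * (\<integral>\<^sup>+y. ennreal (f y * exp (y / g)) * indicator {0..?Y} y \<partial>lborel)"
      by (rule nn_integral_cmult) simp
    also have "\<dots> = ennreal (indicator {t..} n * (?K * \<Phi> ?Y))"
    proof (cases "t \<le> n")
      case True
      then have "(\<integral>\<^sup>+y. ennreal (f y * exp (y / g)) * indicator {0..?Y} y \<partial>lborel) = ennreal (\<Phi> ?Y - \<Phi> 0)"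
        using pos f_nonneg by (intro nn_integral_FTC_Icc \<Phi>(2)) auto
      then show ?thesis using True pos \<Phi>(1) by (simp add: ennreal_mult'[symmetric])
    next
      \<comment> \<open>Below \<open>t\<close> no \<open>y\<close> is admissible, in agreement with
        \<open>indicator {t..}\<close>.\<close>
      case False
      then have "?Y < 0" using pos by (simp add: field_simps)
      then have "{0..?Y} = {}" by auto
      then show ?thesis using False by simp
    qed
    finally show "(\<integral>\<^sup>+y. ?fI y * ?fH (n - y) * indicator {z. t * (1 + y) < z} (n - y) * ennreal (exp (- t / (h * n))) \<partial>lborel)
      = ennreal (indicator {t..} n * (?K * \<Phi> ?Y))" .
  qed
  also have "\<dots> = ennreal (integral\<^sup>L lborel (\<lambda>n. indicator {t..} n * (1 / g * exp (- n / g - t / (h * n)) * \<Phi> ((n - t) / (1 + t)))))"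
  proof (rule nn_integral_eq_integral)
    show "integrable lborel (\<lambda>n. indicator {t..} n * (1 / g * exp (- n / g - t / (h * n)) * \<Phi> ((n - t) / (1 + t))))"
      using Q by (simp add: has_bochner_integral_iff)
    show "AE n in lborel. 0 \<le> indicator {t..} n * (1 / g * exp (- n / g - t / (h * n)) * \<Phi> ((n - t) / (1 + t)))"
      by (intro AE_I2 nonneg)
  qed
  finally have "ennreal (measure M ((\<lambda>x. ((I x, H x), W x)) -` S \<inter> space M)) = ennreal Q"
    using Q by (simp add: has_bochner_integral_iff emeasure_eq_measure)
  moreover have "0 \<le> Q"
    unfolding has_bochner_integral_integral_eq[OF Q, symmetric]
    by (intro Bochner_Integration.integral_nonneg nonneg)
  moreover have "(\<lambda>x. ((I x, H x), W x)) -` S \<inter> space M = {x \<in> space M. H x / (1 + I x) > t \<and> W x * (H x + I x) > t}"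
    by (auto simp: S_def)
  ultimately show ?thesis by (simp add: ennreal_inj)
qed

section \<open>From the success probability to the outage formula\<close>

text \<open>For power splitting, \<open>\<theta> = 1\<close> is a valid fraction but makes every
  mean zero; the sign of \<open>1 - \<theta>\<close> is common to all links, so one positive mean
  settles the others.\<close>

lemma relay_mean_snr_pos:
  assumes "0 < relay_mean_snr scheme \<sigma> P \<Omega>" "0 < P" "0 < \<Omega>" "0 < P'" "0 < \<Omega>'" "0 < \<sigma>"
  shows "0 < relay_mean_snr scheme \<sigma> P' \<Omega>'"
proof (cases scheme)
  case (Power_Splitting \<theta>)
  have "(1 - \<theta>) * P / \<sigma>\<^sup>2 * \<Omega> = (1 - \<theta>) * (P / \<sigma>\<^sup>2 * \<Omega>)" by simp
  moreover have "0 < P / \<sigma>\<^sup>2 * \<Omega>" using assms by simp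
  ultimately have "0 < 1 - \<theta>"
    using assms(1) Power_Splitting by (simp only: relay_mean_snr.simps zero_less_mult_pos2)
  then show ?thesis using assms Power_Splitting by simp
qed (use assms in simp)

lemma (in prob_space) outage_prob_eq_1_minus_success:
  assumes [measurable]: "SR \<in> borel_measurable M" "RD \<in> borel_measurable M"
  shows "outage_prob M SR RD t = 1 - measure M {x \<in> space M. SR x > t \<and> RD x > t}"
proof -
  have "outage_prob M SR RD t
    = measure M ({x \<in> space M. SR x \<le> t} \<union> {x \<in> space M. SR x > t \<and> RD x \<le> t})"
    unfolding outage_prob_def by (subst finite_measure_Union) auto
  also have "{x \<in> space M. SR x \<le> t} \<union> {x \<in> space M. SR x > t \<and> RD x \<le> t}
    = space M - {x \<in> space M. SR x > t \<and> RD x > t}" by auto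
  also have "measure M \<dots> = 1 - measure M {x \<in> space M. SR x > t \<and> RD x > t}"
    by (rule prob_compl) simp
  finally show ?thesis .
qed

theorem theorem3:
  fixes M :: "'a measure"
    and \<gamma>\<^sub>h W :: "'a \<Rightarrow> real" and \<omega> :: "'m::finite \<Rightarrow> 'a \<Rightarrow> real"
    and scheme :: eh_scheme
    and P\<^sub>S \<Omega>\<^sub>h \<Omega>\<^sub>g \<sigma>\<^sub>R \<sigma>\<^sub>D \<eta> \<gamma>\<^sub>t\<^sub>h :: real and P \<Omega>\<^sub>\<beta> :: "'m \<Rightarrow> real"
    and g\<^sub>h g\<^sub>g :: real and \<mu> :: "'m \<Rightarrow> real"
    and A :: "real^'m^'m" and a b :: "nat \<Rightarrow> real"
  assumes "prob_space M"
    and "valid_scheme scheme" and "0 \<le> \<eta>" and "\<eta> \<le> 1"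
    and "0 < P\<^sub>S" and "\<And>i. 0 < P i"
    and "0 < \<Omega>\<^sub>h" and "0 < \<Omega>\<^sub>g" and "\<And>i. 0 < \<Omega>\<^sub>\<beta> i"
    and "0 < \<sigma>\<^sub>R" and "0 < \<sigma>\<^sub>D"
    and "0 < \<gamma>\<^sub>t\<^sub>h"
    and "g\<^sub>h = relay_mean_snr scheme \<sigma>\<^sub>R P\<^sub>S \<Omega>\<^sub>h"
    and "\<And>i. \<mu> i = relay_mean_snr scheme \<sigma>\<^sub>R (P i) (\<Omega>\<^sub>\<beta> i)"
    and "g\<^sub>g = dest_mean_gain scheme \<eta> \<sigma>\<^sub>R \<sigma>\<^sub>D \<Omega>\<^sub>g"
    and "exponential_with_mean M \<gamma>\<^sub>h g\<^sub>h"
    and "\<And>i. exponential_with_mean M (\<omega> i) 1"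
    and "exponential_with_mean M W g\<^sub>g"
    and "prob_space.indep_vars M (\<lambda>_. borel) (case_link \<gamma>\<^sub>h \<omega> W) UNIV"
    and "A = diag_matrix \<mu>"
    and "\<And>i. \<mu> i \<noteq> g\<^sub>h"
    and "\<And>i. a i = 1 / diag_nth A i - 1 / g\<^sub>h"
    and "\<And>i. b i = 1 / g\<^sub>h + a i / (1 + \<gamma>\<^sub>t\<^sub>h)"
  shows "outage_prob M (sinr_relay \<mu> \<gamma>\<^sub>h \<omega>) (snr_dest \<mu> \<gamma>\<^sub>h \<omega> W) \<gamma>\<^sub>t\<^sub>h =
    1 - (\<Sum>i=1..num_distinct A. \<Sum>j=1..diag_mult A i.
      char_coeff A i j * (1 - diag_nth A i / g\<^sub>h) powi (- int j) *
      (gen_inc_Gamma 1 (\<gamma>\<^sub>t\<^sub>h / g\<^sub>h) (\<gamma>\<^sub>t\<^sub>h / (g\<^sub>h * g\<^sub>g))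
       - 1 / g\<^sub>h * exp (a i * \<gamma>\<^sub>t\<^sub>h / (1 + \<gamma>\<^sub>t\<^sub>h)) *
         (\<Sum>k=0..j-1. 1 / fact k * (- a i * \<gamma>\<^sub>t\<^sub>h / (1 + \<gamma>\<^sub>t\<^sub>h)) ^ k *
           (\<Sum>m=0..k. real (k choose m) * (inverse (b i) / (- b i * \<gamma>\<^sub>t\<^sub>h) ^ m) *
             gen_inc_Gamma (real m + 1) (b i * \<gamma>\<^sub>t\<^sub>h) (b i * \<gamma>\<^sub>t\<^sub>h / g\<^sub>g)))))"
proof -
  interpret prob_space M by fact
  let ?t = "\<gamma>\<^sub>t\<^sub>h"
  have g: "0 < g\<^sub>h" "0 < g\<^sub>g" and t: "0 < ?t"
    and H: "distributed M lborel \<gamma>\<^sub>h (exponential_density (1 / g\<^sub>h))"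
    and W: "distributed M lborel W (exponential_density (1 / g\<^sub>g))"
    and \<omega>: "\<And>i. distributed M lborel (\<omega> i) (exponential_density 1)"
    using assms(12,16,17,18) by (auto simp: exponential_with_mean_def)
  have \<mu>: "0 < \<mu> i" for i
    using relay_mean_snr_pos[of scheme \<sigma>\<^sub>R P\<^sub>S \<Omega>\<^sub>h "P i" "\<Omega>\<^sub>\<beta> i"] assms(5,6,7,9,10,13,14) g by simp
  \<comment> \<open>Each interferer variable is scaled by its \<open>\<mu> i\<close>, so that the
    interference becomes a plain sum; maps applied link by link preserve independence.\<close>
  define Y where "Y = case_link (\<lambda>x::real. x) (\<lambda>(i::'m) x. \<mu> i * x) (\<lambda>x. x)"
  define Z where "Z l x = Y l (case_link \<gamma>\<^sub>h \<omega> W l x)" for l x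
  have Z_simps: "Z Source_Relay = \<gamma>\<^sub>h" "Z Relay_Destination = W" "Z (Interferer i) = (\<lambda>x. \<mu> i * \<omega> i x)" for i
    by (auto simp: Z_def Y_def fun_eq_iff)
  have indep: "indep_vars (\<lambda>_. borel) Z UNIV"
    unfolding Z_def[abs_def]
    by (rule indep_vars_compose2[OF assms(19)]) (auto simp: Y_def split: link.split)
  have inj: "inj (Interferer :: 'm \<Rightarrow> 'm link)" by (simp add: inj_on_def)
  define S where "S = range (Interferer :: 'm \<Rightarrow> 'm link)"
  \<comment> \<open>The value 1 at the two other links is a filler: \<open>S\<close> consists of
    interferers alone.\<close>
  define \<mu>' where "\<mu>' = case_link 1 \<mu> 1"
  have S: "finite S" "S \<noteq> {}" by (auto simp: S_def)
  have sumZ: "(\<lambda>x. \<Sum>l\<in>S. Z l x) = interference \<mu> \<omega>"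
    by (auto simp: S_def sum.reindex[OF inj] Z_simps interference_def fun_eq_iff)
  have Zd: "distributed M lborel (Z l) (exponential_density (1 / \<mu>' l))" if l: "l \<in> S" for l
  proof -
    obtain i where i: "l = Interferer i" using l by (auto simp: S_def)
    have "distributed M lborel (\<lambda>x. 0 + \<mu> i * \<omega> i x) (\<lambda>x. ennreal (exponential_density 1 ((x - 0) / \<mu> i)) / ennreal \<bar>\<mu> i\<bar>)"
      using \<mu>[of i] by (intro distributed_affine \<omega>) auto
    also have "(\<lambda>x. ennreal (exponential_density 1 ((x - 0) / \<mu> i)) / ennreal \<bar>\<mu> i\<bar>) = (\<lambda>x. ennreal (exponential_density (1 / \<mu> i) x))"
      using \<mu>[of i] by (auto simp: fun_eq_iff exponential_density_def divide_ennreal divide_less_0_iff)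
    finally show ?thesis by (simp add: i Z_simps \<mu>'_def)
  qed
  have "\<exists>f F. gamma_span (\<lambda>v. card {l \<in> S. \<mu>' l = v}) f F \<and>
    (\<forall>s. (\<forall>l\<in>S. 1 + s * \<mu>' l \<noteq> 0) \<longrightarrow> F s = (\<Prod>l\<in>S. 1 / (1 + s * \<mu>' l))) \<and>
    (\<forall>y\<ge>0. 0 \<le> f y) \<and>
    distributed M lborel (\<lambda>x. \<Sum>l\<in>S. Z l x) (\<lambda>y. ennreal (f y * indicator {0..} y))"
    by (rule exponential_sum_density[OF S indep_vars_subset[OF indep] _ Zd])
      (auto simp: S_def \<mu>'_def \<mu>)
  then obtain f F where f: "gamma_span (\<lambda>v. card {l \<in> S. \<mu>' l = v}) f F \<and>
    (\<forall>s. (\<forall>l\<in>S. 1 + s * \<mu>' l \<noteq> 0) \<longrightarrow> F s = (\<Prod>l\<in>S. 1 / (1 + s * \<mu>' l))) \<and>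
    (\<forall>y\<ge>0. 0 \<le> f y) \<and>
    distributed M lborel (\<lambda>x. \<Sum>l\<in>S. Z l x) (\<lambda>y. ennreal (f y * indicator {0..} y))"
    by (elim exE) (rule that)
  have A: "A $ m $ m = \<mu> m" for m by (simp add: assms(20) diag_matrix_def)
  \<comment> \<open>\<open>Interferer\<close> is injective, so multiplicities over links are those
    of the diagonal entries.\<close>
  have "{l \<in> S. \<mu>' l = v} = Interferer ` {m. \<mu> m = v}" for v
    by (auto simp: S_def \<mu>'_def)
  then have card: "card {l \<in> S. \<mu>' l = v} = card {m. A $ m $ m = v}" for v
    by (simp add: card_image inj_on_subset[OF inj] A)
  have "\<exists>C. (\<forall>y. f y = (\<Sum>v\<in>diag_elems A. \<Sum>j=1..card {m. A $ m $ m = v}. C v j * gamma_kernel v j y)) \<and>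
    (\<forall>s. F s = (\<Sum>v\<in>diag_elems A. \<Sum>j=1..card {m. A $ m $ m = v}. C v j / (1 + s * v) ^ j))"
  proof (rule gamma_span_coefficients)
    show "gamma_span (\<lambda>v. card {m. A $ m $ m = v}) f F" using f unfolding card by blast
    show "finite (diag_elems A)" by (simp add: diag_elems_def)
    show "card {m. A $ m $ m = v} = 0" if "v \<notin> diag_elems A" for v
      using that by (auto simp: diag_elems_def)
  qed
  then obtain C where C: "\<And>y. f y = (\<Sum>v\<in>diag_elems A. \<Sum>j=1..card {m. A $ m $ m = v}. C v j * gamma_kernel v j y)"
    "\<And>s. F s = (\<Sum>v\<in>diag_elems A. \<Sum>j=1..card {m. A $ m $ m = v}. C v j / (1 + s * v) ^ j)"
    by (elim exE conjE) (rule that, simp_all)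
  \<comment> \<open>The mixture weights and the partial fraction coefficients are the same
    \<open>C\<close>, so uniqueness of the latter turns the weights into characteristic
    coefficients.\<close>
  have c: "char_coeff A i j = C (diag_nth A i) j" if "i \<in> {1..num_distinct A}" "j \<in> {1..diag_mult A i}" for i j
  proof (rule char_coeff_eq[OF _ _ that])
    show "A $ m $ m \<noteq> 0" for m using \<mu>[of m] by (simp add: A)
    fix s assume s: "\<forall>m. 1 + s * A $ m $ m \<noteq> 0"
    have "(\<Prod>m\<in>UNIV. 1 / (1 + s * A $ m $ m)) = (\<Prod>l\<in>S. 1 / (1 + s * \<mu>' l))"
      by (simp add: S_def prod.reindex[OF inj] \<mu>'_def A)
    also have "\<dots> = F s" using f s by (auto simp: S_def \<mu>'_def A)
    finally show "(\<Prod>m\<in>UNIV. 1 / (1 + s * A $ m $ m)) =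
      (\<Sum>v\<in>diag_elems A. \<Sum>j=1..card {m. A $ m $ m = v}. C v j / (1 + s * v) ^ j)"
      unfolding C(2) .
  qed
  have f_eq: "f y = (\<Sum>i=1..num_distinct A. \<Sum>j=1..diag_mult A i. char_coeff A i j * gamma_kernel (diag_nth A i) j y)" for y
    unfolding C(1) sum_diag_elems_eq by (intro sum.cong refl) (simp add: c)
  \<comment> \<open>The antiderivative of \<open>f y * exp (y / g\<^sub>h)\<close> that vanishes at
    0, assembled term by term from the mixture.\<close>
  define \<Phi> where "\<Phi> y = (\<Sum>i=1..num_distinct A. \<Sum>j=1..diag_mult A i.
    char_coeff A i j * tilted_gamma_cdf (diag_nth A i) g\<^sub>h j y)" for y
  have nth: "0 < diag_nth A i" "diag_nth A i \<noteq> g\<^sub>h" if "i \<in> {1..num_distinct A}" for i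
  proof -
    have "diag_nth A i \<in> diag_elems A" using bij_betw_diag_nth[of A] that by (auto simp: bij_betw_def)
    then obtain m where "diag_nth A i = \<mu> m" by (auto simp: diag_elems_def A)
    then show "0 < diag_nth A i" "diag_nth A i \<noteq> g\<^sub>h" using \<mu>[of m] assms(21)[of m] by auto
  qed
  have D\<Phi>: "(\<Phi> has_field_derivative f y * exp (y / g\<^sub>h)) (at y)" for y
  proof -
    have "(\<Phi> has_field_derivative (\<Sum>i=1..num_distinct A. \<Sum>j=1..diag_mult A i.
      char_coeff A i j * (gamma_kernel (diag_nth A i) j y * exp (y / g\<^sub>h)))) (at y)"
      unfolding \<Phi>_def[abs_def]
      by (intro DERIV_sum DERIV_cmult has_field_derivative_tilted_gamma_cdf)
        (use nth g in \<open>force+\<close>)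
    then show ?thesis by (simp add: f_eq sum_distrib_right mult.assoc)
  qed
  let ?T = "\<lambda>i j. (1 - diag_nth A i / g\<^sub>h) powi (- int j) *
      (gen_inc_Gamma 1 (?t / g\<^sub>h) (?t / (g\<^sub>h * g\<^sub>g))
       - 1 / g\<^sub>h * exp (a i * ?t / (1 + ?t)) *
         (\<Sum>k=0..j-1. 1 / fact k * (- a i * ?t / (1 + ?t)) ^ k *
           (\<Sum>m=0..k. real (k choose m) * (inverse (b i) / (- b i * ?t) ^ m) *
             gen_inc_Gamma (real m + 1) (b i * ?t) (b i * ?t / g\<^sub>g))))"
  let ?K = "\<lambda>n. 1 / g\<^sub>h * exp (- n / g\<^sub>h - ?t / (g\<^sub>g * n))"
  have "has_bochner_integral lborel (\<lambda>n. \<Sum>i=1..num_distinct A. \<Sum>j=1..diag_mult A i. char_coeff A i j *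
      (indicator {?t..} n * (?K n * tilted_gamma_cdf (diag_nth A i) g\<^sub>h j ((n - ?t) / (1 + ?t)))))
    (\<Sum>i=1..num_distinct A. \<Sum>j=1..diag_mult A i. char_coeff A i j * ?T i j)"
  proof (intro has_bochner_integral_sum has_bochner_integral_mult_right)
    fix i j assume i: "i \<in> {1..num_distinct A}"
    show "has_bochner_integral lborel
      (\<lambda>n. indicator {?t..} n * (?K n * tilted_gamma_cdf (diag_nth A i) g\<^sub>h j ((n - ?t) / (1 + ?t)))) (?T i j)"
      by (rule has_bochner_integral_tilted_gamma_cdf[OF nth(1)[OF i] g(1) nth(2)[OF i] g(2) t assms(22) assms(23)])
  qed
  also have "(\<lambda>n. \<Sum>i=1..num_distinct A. \<Sum>j=1..diag_mult A i. char_coeff A i j *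
      (indicator {?t..} n * (?K n * tilted_gamma_cdf (diag_nth A i) g\<^sub>h j ((n - ?t) / (1 + ?t)))))
    = (\<lambda>n. indicator {?t..} n * (?K n * \<Phi> ((n - ?t) / (1 + ?t))))"
    unfolding \<Phi>_def sum_distrib_left by (simp only: mult_ac)
  finally have Q: "has_bochner_integral lborel (\<lambda>n. indicator {?t..} n * (?K n * \<Phi> ((n - ?t) / (1 + ?t))))
    (\<Sum>i=1..num_distinct A. \<Sum>j=1..diag_mult A i. char_coeff A i j * ?T i j)" .
  \<comment> \<open>The interference and \<open>\<gamma>\<^sub>h\<close> are functions of disjoint
    blocks of links; the same grouping below separates this pair from \<open>W\<close>.\<close>
  have "indep_var lborel ((\<lambda>z. \<Sum>l\<in>S. z l) \<circ> (\<lambda>x. restrict (\<lambda>l. Z l x) S))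
      lborel ((\<lambda>z. z Source_Relay) \<circ> (\<lambda>x. restrict (\<lambda>l. Z l x) {Source_Relay}))"
    by (rule indep_var_compose[OF indep_var_restrict[OF indep]]) (auto simp: S_def)
  then have IH: "indep_var lborel (interference \<mu> \<omega>) lborel \<gamma>\<^sub>h"
    by (simp add: comp_def sumZ Z_simps)
  have "distr M (lborel \<Otimes>\<^sub>M lborel)
        (\<lambda>x. (\<lambda>z. (\<Sum>l\<in>S. z l, z Source_Relay)) (restrict (\<lambda>l. Z l x) (insert Source_Relay S))) \<Otimes>\<^sub>M
      distr M lborel (\<lambda>x. (\<lambda>z. z Relay_Destination) (restrict (\<lambda>l. Z l x) {Relay_Destination}))
    = distr M ((lborel \<Otimes>\<^sub>M lborel) \<Otimes>\<^sub>M lborel)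
        (\<lambda>x. ((\<lambda>z. (\<Sum>l\<in>S. z l, z Source_Relay)) (restrict (\<lambda>l. Z l x) (insert Source_Relay S)),
          (\<lambda>z. z Relay_Destination) (restrict (\<lambda>l. Z l x) {Relay_Destination})))"
    by (rule indep_var_compose_distr_pair[OF indep_var_restrict[OF indep]]) (auto simp: S_def)
  then have IHW: "distr M (lborel \<Otimes>\<^sub>M lborel) (\<lambda>x. (interference \<mu> \<omega> x, \<gamma>\<^sub>h x)) \<Otimes>\<^sub>M distr M lborel W
    = distr M ((lborel \<Otimes>\<^sub>M lborel) \<Otimes>\<^sub>M lborel) (\<lambda>x. ((interference \<mu> \<omega> x, \<gamma>\<^sub>h x), W x))"
    by (simp add: sumZ[symmetric] Z_simps)
  have I: "distributed M lborel (interference \<mu> \<omega>) (\<lambda>y. ennreal (f y * indicator {0..} y))"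
    using f by (simp add: sumZ)
  have mf: "f \<in> borel_measurable borel" using f borel_measurable_gamma_span by blast
  have f0: "0 \<le> f y" if "0 \<le> y" for y using f that by blast
  have \<Phi>0: "\<Phi> 0 = 0" unfolding \<Phi>_def by (intro sum.neutral ballI) (simp add: tilted_gamma_cdf_0)
  have [measurable]: "interference \<mu> \<omega> \<in> borel_measurable M" "\<gamma>\<^sub>h \<in> borel_measurable M" "W \<in> borel_measurable M"
    using distributed_measurable[OF I] distributed_measurable[OF H] distributed_measurable[OF W] by simp_all
  have "outage_prob M (sinr_relay \<mu> \<gamma>\<^sub>h \<omega>) (snr_dest \<mu> \<gamma>\<^sub>h \<omega> W) ?t
    = 1 - measure M {x \<in> space M. sinr_relay \<mu> \<gamma>\<^sub>h \<omega> x > ?t \<and> snr_dest \<mu> \<gamma>\<^sub>h \<omega> W x > ?t}"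
    by (rule outage_prob_eq_1_minus_success) (simp_all add: sinr_relay_def[abs_def] snr_dest_def[abs_def])
  also have "measure M {x \<in> space M. sinr_relay \<mu> \<gamma>\<^sub>h \<omega> x > ?t \<and> snr_dest \<mu> \<gamma>\<^sub>h \<omega> W x > ?t}
    = (\<Sum>i=1..num_distinct A. \<Sum>j=1..diag_mult A i. char_coeff A i j * ?T i j)"
    unfolding sinr_relay_def snr_dest_def
    by (rule relay_success_prob[OF g t H W I mf f0 IH IHW \<Phi>0 D\<Phi> Q])
  finally show ?thesis by (simp only: mult.assoc)
qed

end
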